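(* For every prime number $p\geq 5$, $$B_1(2,\mathbb{Q}_p)=B_{\rm m}(2,\mathbb{Q}_p)=3(p-1).$$
   Context: For a field $K$, $B_1(2,K)$ (resp. $B_{\rm m}(2,K)$) denotes the supremum of the number of roots in $K^\ast=K\setminus\{0\}$, counted without (resp. with) multiplicities, that a non-zero polynomial in $K[x]$ with at most $3$ monomial terms can have. *)

theory Defs
  imports
    Complex_Main
    "HOL-Library.Extended_Nat"
    "HOL-Computational_Algebra.Polynomial"
    "Berlekamp_Zassenhaus.Finite_Field"
begin

section \<open>The \<open>p\<close>-adic absolute value on the rational numbers\<close>

text \<open>The multiplicities are taken in \<^typ>\<open>int\<close>: in the field \<^typ>\<open>rat\<close> every
  nonzero element is a unit.\<close>

definition padic_abs :: "nat \<Rightarrow> rat \<Rightarrow> real" where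
  "padic_abs p r = (if r = 0 then 0 else
     (case quotient_of r of (a, b) \<Rightarrow>
        real p powi (int (multiplicity (int p) b) - int (multiplicity (int p) a))))"

lemma padic_abs_0 [simp]: "padic_abs p 0 = 0"
  by (simp add: padic_abs_def)

lemma padic_abs_of_int_divide:
  assumes p: "prime p" and "a \<noteq> 0" "b \<noteq> 0"
  shows "padic_abs p (of_int a / of_int b) =
    real p powi (int (multiplicity (int p) b) - int (multiplicity (int p) a))"
proof -
  let ?r = "of_int a / of_int b :: rat"
  obtain c d where q: "quotient_of ?r = (c, d)" by force
  have d: "d > 0" using quotient_of_denom_pos[OF q] .
  have eq: "?r = of_int c / of_int d" using quotient_of_div[OF q] .
  have r0: "?r \<noteq> 0" using assms by simp
  hence c: "c \<noteq> 0" using eq by auto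
  have "of_int (a * d) = (of_int (b * c) :: rat)"
    using eq d assms by (simp add: field_simps)
  hence adbc: "a * d = b * c" by linarith
  have pe: "prime_elem (int p)" using p by simp
  have "multiplicity (int p) (a * d) = multiplicity (int p) a + multiplicity (int p) d"
    using pe assms d by (intro prime_elem_multiplicity_mult_distrib) auto
  moreover have "multiplicity (int p) (b * c) = multiplicity (int p) b + multiplicity (int p) c"
    using pe assms c by (intro prime_elem_multiplicity_mult_distrib) auto
  ultimately have "multiplicity (int p) a + multiplicity (int p) d
      = multiplicity (int p) b + multiplicity (int p) c"
    using adbc by simp
  hence "int (multiplicity (int p) d) - int (multiplicity (int p) c)
      = int (multiplicity (int p) b) - int (multiplicity (int p) a)" by linarith
  thus ?thesis unfolding padic_abs_def q using r0 by simp
qed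

lemma rat_nonzero_cases:
  assumes "(r :: rat) \<noteq> 0"
  obtains a b where "a \<noteq> 0" "b > 0" "r = of_int a / of_int b"
proof -
  obtain a b where q: "quotient_of r = (a, b)" by force
  show ?thesis
    using that[of a b] quotient_of_denom_pos[OF q] quotient_of_div[OF q] assms by auto
qed

lemma padic_abs_pos:
  assumes "prime p" "r \<noteq> 0" shows "padic_abs p r > 0"
proof -
  obtain a b where "quotient_of r = (a, b)" by force
  thus ?thesis using assms by (auto simp: padic_abs_def prime_gt_0_nat)
qed

lemma padic_abs_ge_0: "prime p \<Longrightarrow> padic_abs p r \<ge> 0"
  using padic_abs_pos[of p r] by (cases "r = 0") auto

lemma padic_abs_1 [simp]: "padic_abs p 1 = 1"
  by (simp add: padic_abs_def)

lemma padic_abs_mult: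
  assumes p: "prime p" shows "padic_abs p (r * s) = padic_abs p r * padic_abs p s"
proof (cases "r = 0 \<or> s = 0")
  case False
  then obtain a b c d where r: "a \<noteq> 0" "b > 0" "r = of_int a / of_int b"
    and s: "c \<noteq> 0" "d > 0" "s = of_int c / of_int d"
    by (metis rat_nonzero_cases)
  have rs: "r * s = of_int (a * c) / of_int (b * d)" using r s by simp
  have pe: "prime_elem (int p)" using p by simp
  have 1: "multiplicity (int p) (a * c) = multiplicity (int p) a + multiplicity (int p) c"
    using pe r s by (intro prime_elem_multiplicity_mult_distrib) auto
  have 2: "multiplicity (int p) (b * d) = multiplicity (int p) b + multiplicity (int p) d"
    using pe r s by (intro prime_elem_multiplicity_mult_distrib) auto
  have p0: "real p \<noteq> 0" using p by auto
  have "padic_abs p (r * s) = real p powi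
      ((int (multiplicity (int p) b) - int (multiplicity (int p) a))
       + (int (multiplicity (int p) d) - int (multiplicity (int p) c)))"
    unfolding rs using p r s
    by (subst padic_abs_of_int_divide) (auto simp: 1 2 algebra_simps)
  also have "\<dots> = padic_abs p r * padic_abs p s"
  proof -
    have "padic_abs p r = real p powi (int (multiplicity (int p) b) - int (multiplicity (int p) a))"
      unfolding r(3) using r by (intro padic_abs_of_int_divide p) auto
    moreover have "padic_abs p s
        = real p powi (int (multiplicity (int p) d) - int (multiplicity (int p) c))"
      unfolding s(3) using s by (intro padic_abs_of_int_divide p) auto
    ultimately show ?thesis using p0 by (simp add: power_int_add)
  qed
  finally show ?thesis .
qed auto

lemma padic_abs_uminus [simp]:
  assumes p: "prime p" shows "padic_abs p (- r) = padic_abs p r"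
proof -
  have "padic_abs p (- 1) = 1"
    by (simp add: padic_abs_def multiplicity_unit_right)
  thus ?thesis using padic_abs_mult[OF p, of "- 1" r] by simp
qed

lemma padic_abs_minus_commute:
  "prime p \<Longrightarrow> padic_abs p (r - s) = padic_abs p (s - r)"
  using padic_abs_uminus[of p "r - s"] by simp

lemma padic_abs_inverse:
  assumes p: "prime p" shows "padic_abs p (inverse r) = inverse (padic_abs p r)"
proof (cases "r = 0")
  case False
  hence "padic_abs p r * padic_abs p (inverse r) = 1"
    using padic_abs_mult[OF p, of r "inverse r"] by simp
  thus ?thesis by (metis inverse_unique)
qed auto

lemma padic_abs_add_le_max:
  assumes p: "prime p" shows "padic_abs p (r + s) \<le> max (padic_abs p r) (padic_abs p s)"
proof (cases "r = 0 \<or> s = 0 \<or> r + s = 0")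
  case True
  thus ?thesis using padic_abs_ge_0[OF p, of r] padic_abs_ge_0[OF p, of s] by auto
next
  case False
  then obtain a b c d where r: "a \<noteq> 0" "b > 0" "r = of_int a / of_int b"
    and s: "c \<noteq> 0" "d > 0" "s = of_int c / of_int d"
    by (metis rat_nonzero_cases)
  define e where "e = b * d"
  define x where "x = a * d"
  define y where "y = c * b"
  have e0: "e \<noteq> 0" and x0: "x \<noteq> 0" and y0: "y \<noteq> 0"
    using r s by (auto simp: e_def x_def y_def)
  have rx: "r = of_int x / of_int e" and sy: "s = of_int y / of_int e"
    using r s by (auto simp: e_def x_def y_def)
  have rs: "r + s = of_int (x + y) / of_int e"
    using rx sy by (simp add: add_divide_distrib)
  have xy0: "x + y \<noteq> 0" using False rs by auto
  let ?m = "multiplicity (int p)"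
  have "int p ^ min (?m x) (?m y) dvd x + y"
    by (intro dvd_add multiplicity_dvd') auto
  hence m: "min (?m x) (?m y) \<le> ?m (x + y)"
    using xy0 p by (intro multiplicity_geI) (auto simp: prime_nat_iff)
  have p1: "real p \<ge> 1" using prime_ge_1_nat[OF p] by simp
  have abs: "padic_abs p (of_int z / of_int e) = real p powi (int (?m e) - int (?m z))"
    if "z \<noteq> 0" for z
    using that e0 by (intro padic_abs_of_int_divide p)
  note abs_rs = abs[OF xy0, folded rs] and abs_r = abs[OF x0, folded rx]
    and abs_s = abs[OF y0, folded sy]
  show ?thesis
  proof (cases "?m x \<le> ?m y")
    case True
    hence "real p powi (int (?m e) - int (?m (x + y))) \<le> real p powi (int (?m e) - int (?m x))"
      using m p1 by (intro power_int_increasing) auto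
    hence "padic_abs p (r + s) \<le> padic_abs p r"
      by (simp only: abs_rs abs_r)
    thus ?thesis by simp
  next
    case False
    hence "real p powi (int (?m e) - int (?m (x + y))) \<le> real p powi (int (?m e) - int (?m y))"
      using m p1 by (intro power_int_increasing) auto
    hence "padic_abs p (r + s) \<le> padic_abs p s"
      by (simp only: abs_rs abs_s)
    thus ?thesis by simp
  qed
qed

lemma padic_abs_triangle:
  "prime p \<Longrightarrow> padic_abs p (r + s) \<le> padic_abs p r + padic_abs p s"
  using padic_abs_add_le_max[of p r s] padic_abs_ge_0[of p r] padic_abs_ge_0[of p s] by linarith

lemma padic_abs_triangle_minus:
  "prime p \<Longrightarrow> padic_abs p (r - s) \<le> padic_abs p r + padic_abs p s"
  using padic_abs_triangle[of p r "- s"] by simp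


section \<open>Cauchy sequences and null sequences\<close>

definition padic_null :: "nat \<Rightarrow> (nat \<Rightarrow> rat) \<Rightarrow> bool" where
  "padic_null p X \<longleftrightarrow> (\<lambda>n. padic_abs p (X n)) \<longlonglongrightarrow> 0"

definition padic_cauchy :: "nat \<Rightarrow> (nat \<Rightarrow> rat) \<Rightarrow> bool" where
  "padic_cauchy p X \<longleftrightarrow> (\<forall>e>0. \<exists>N. \<forall>m\<ge>N. \<forall>n\<ge>N. padic_abs p (X m - X n) < e)"

lemma padic_null_le:
  assumes p: "prime p" and Y: "Y \<longlonglongrightarrow> 0"
    and le: "eventually (\<lambda>n. padic_abs p (X n) \<le> Y n) sequentially"
  shows "padic_null p X"
  unfolding padic_null_def
  by (rule tendsto_sandwich[OF _ le tendsto_const Y]) (simp add: padic_abs_ge_0 p)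

lemma padic_null_zero [simp]: "padic_null p (\<lambda>n. 0)"
  by (simp add: padic_null_def)

lemma padic_null_add:
  assumes p: "prime p" and "padic_null p X" "padic_null p Y"
  shows "padic_null p (\<lambda>n. X n + Y n)"
proof (rule padic_null_le[OF p])
  show "(\<lambda>n. padic_abs p (X n) + padic_abs p (Y n)) \<longlonglongrightarrow> 0"
    using tendsto_add[of _ 0 sequentially _ 0] assms by (simp add: padic_null_def)
qed (simp add: padic_abs_triangle p)

lemma padic_null_uminus:
  "prime p \<Longrightarrow> padic_null p X \<Longrightarrow> padic_null p (\<lambda>n. - X n)"
  by (simp add: padic_null_def)

lemma padic_null_minus_commute:
  "prime p \<Longrightarrow> padic_null p (\<lambda>n. X n - Y n) \<longleftrightarrow> padic_null p (\<lambda>n. Y n - X n)"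
  by (simp add: padic_null_def padic_abs_minus_commute[of p "X _"])

lemma padic_cauchy_const [simp]: "padic_cauchy p (\<lambda>n. c)"
  by (simp add: padic_cauchy_def)

lemma padic_cauchyD:
  "padic_cauchy p X \<Longrightarrow> e > 0 \<Longrightarrow> \<exists>N. \<forall>m\<ge>N. \<forall>n\<ge>N. padic_abs p (X m - X n) < e"
  by (simp add: padic_cauchy_def)

lemma padic_cauchy_uminus:
  assumes p: "prime p" and X: "padic_cauchy p X"
  shows "padic_cauchy p (\<lambda>n. - X n)"
proof -
  have "padic_abs p (- X m - - X n) = padic_abs p (X m - X n)" for m n
    using padic_abs_uminus[OF p, of "X m - X n"] by simp
  thus ?thesis using X by (simp add: padic_cauchy_def)
qed

lemma padic_cauchy_add:
  assumes p: "prime p" and X: "padic_cauchy p X" and Y: "padic_cauchy p Y"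
  shows "padic_cauchy p (\<lambda>n. X n + Y n)"
  unfolding padic_cauchy_def
proof (intro allI impI)
  fix e :: real assume e: "e > 0"
  obtain M where M: "\<forall>m\<ge>M. \<forall>n\<ge>M. padic_abs p (X m - X n) < e / 2"
    using padic_cauchyD[OF X, of "e / 2"] e by auto
  obtain N where N: "\<forall>m\<ge>N. \<forall>n\<ge>N. padic_abs p (Y m - Y n) < e / 2"
    using padic_cauchyD[OF Y, of "e / 2"] e by auto
  have "padic_abs p (X m + Y m - (X n + Y n)) < e" if "m \<ge> max M N" "n \<ge> max M N" for m n
  proof -
    have "padic_abs p (X m + Y m - (X n + Y n))
        \<le> padic_abs p (X m - X n) + padic_abs p (Y m - Y n)"
      using padic_abs_triangle[OF p, of "X m - X n" "Y m - Y n"] by (simp add: algebra_simps)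
    moreover have "padic_abs p (X m - X n) < e / 2" "padic_abs p (Y m - Y n) < e / 2"
      using M N that by auto
    ultimately show ?thesis by linarith
  qed
  thus "\<exists>N. \<forall>m\<ge>N. \<forall>n\<ge>N. padic_abs p (X m + Y m - (X n + Y n)) < e" by blast
qed

lemma padic_cauchy_bounded:
  assumes p: "prime p" and X: "padic_cauchy p X"
  shows "\<exists>B>0. \<forall>n. padic_abs p (X n) \<le> B"
proof -
  obtain N where N: "\<forall>m\<ge>N. \<forall>n\<ge>N. padic_abs p (X m - X n) < 1"
    using padic_cauchyD[OF X, of 1] by auto
  define B where "B = Max ((\<lambda>n. padic_abs p (X n)) ` {..N}) + 1"
  have le: "padic_abs p (X n) \<le> B - 1" if "n \<le> N" for n
    unfolding B_def using that by (auto intro!: Max_ge)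
  have "padic_abs p (X n) \<le> B" for n
  proof (cases "n \<le> N")
    case True
    thus ?thesis using le[of n] by simp
  next
    case False
    hence "padic_abs p (X n - X N) < 1" using N by simp
    moreover have "padic_abs p (X n) \<le> padic_abs p (X n - X N) + padic_abs p (X N)"
      using padic_abs_triangle[OF p, of "X n - X N" "X N"] by simp
    ultimately show ?thesis using le[of N] by simp
  qed
  moreover have "B > 0" using le[of N] padic_abs_ge_0[OF p, of "X N"] by simp
  ultimately show ?thesis by blast
qed

lemma padic_cauchy_mult:
  assumes p: "prime p" and X: "padic_cauchy p X" and Y: "padic_cauchy p Y"
  shows "padic_cauchy p (\<lambda>n. X n * Y n)"
  unfolding padic_cauchy_def
proof (intro allI impI)
  fix e :: real assume e: "e > 0"
  obtain B where B: "B > 0" "\<And>n. padic_abs p (X n) \<le> B"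
    using padic_cauchy_bounded[OF p X] by blast
  obtain C where C: "C > 0" "\<And>n. padic_abs p (Y n) \<le> C"
    using padic_cauchy_bounded[OF p Y] by blast
  obtain M where M: "\<forall>m\<ge>M. \<forall>n\<ge>M. padic_abs p (X m - X n) < e / (2 * C)"
    using padic_cauchyD[OF X, of "e / (2 * C)"] e C by auto
  obtain N where N: "\<forall>m\<ge>N. \<forall>n\<ge>N. padic_abs p (Y m - Y n) < e / (2 * B)"
    using padic_cauchyD[OF Y, of "e / (2 * B)"] e B by auto
  have "padic_abs p (X m * Y m - X n * Y n) < e" if mn: "m \<ge> max M N" "n \<ge> max M N" for m n
  proof -
    have "X m * Y m - X n * Y n = X m * (Y m - Y n) + (X m - X n) * Y n"
      by (simp add: algebra_simps)
    hence "padic_abs p (X m * Y m - X n * Y n)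
        \<le> padic_abs p (X m) * padic_abs p (Y m - Y n) + padic_abs p (X m - X n) * padic_abs p (Y n)"
      using padic_abs_triangle[OF p, of "X m * (Y m - Y n)" "(X m - X n) * Y n"]
      by (simp add: padic_abs_mult[OF p])
    also have "\<dots> \<le> B * padic_abs p (Y m - Y n) + padic_abs p (X m - X n) * C"
      by (intro add_mono mult_mono B C order.refl padic_abs_ge_0[OF p]) (use B in auto)
    also have "\<dots> < B * (e / (2 * B)) + e / (2 * C) * C"
      using M N mn B C by (intro add_strict_mono mult_strict_left_mono mult_strict_right_mono) auto
    also have "\<dots> = e" using B C by simp
    finally show ?thesis .
  qed
  thus "\<exists>N. \<forall>m\<ge>N. \<forall>n\<ge>N. padic_abs p (X m * Y m - X n * Y n) < e" by blast
qed

lemma padic_null_mult: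
  assumes p: "prime p" and X: "padic_cauchy p X" and Y: "padic_null p Y"
  shows "padic_null p (\<lambda>n. X n * Y n)"
proof -
  obtain B where B: "B > 0" "\<And>n. padic_abs p (X n) \<le> B"
    using padic_cauchy_bounded[OF p X] by blast
  show ?thesis
  proof (rule padic_null_le[OF p])
    show "(\<lambda>n. B * padic_abs p (Y n)) \<longlonglongrightarrow> 0"
      using tendsto_mult_left[of _ 0 sequentially B] Y by (simp add: padic_null_def)
    show "eventually (\<lambda>n. padic_abs p (X n * Y n) \<le> B * padic_abs p (Y n)) sequentially"
      by (intro always_eventually allI)
        (simp add: padic_abs_mult[OF p] mult_right_mono B padic_abs_ge_0[OF p])
  qed
qed

lemma padic_cauchy_not_null:
  assumes p: "prime p" and X: "padic_cauchy p X" and nz: "\<not> padic_null p X"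
  shows "\<exists>b>0. \<exists>N. \<forall>n\<ge>N. padic_abs p (X n) \<ge> b"
proof -
  obtain e where e: "e > 0" "\<And>N. \<exists>n\<ge>N. padic_abs p (X n) \<ge> e"
    using nz padic_abs_ge_0[OF p] unfolding padic_null_def LIMSEQ_iff
    by (auto simp: not_less)
  obtain N where N: "\<forall>m\<ge>N. \<forall>n\<ge>N. padic_abs p (X m - X n) < e / 2"
    using padic_cauchyD[OF X, of "e / 2"] e by auto
  obtain k where k: "k \<ge> N" "padic_abs p (X k) \<ge> e" using e by blast
  have "padic_abs p (X n) \<ge> e / 2" if "n \<ge> N" for n
  proof -
    have "padic_abs p (X k) \<le> padic_abs p (X k - X n) + padic_abs p (X n)"
      using padic_abs_triangle[OF p, of "X k - X n" "X n"] by simp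
    moreover have "padic_abs p (X k - X n) < e / 2" using N k that by simp
    ultimately show ?thesis using k by simp
  qed
  thus ?thesis using e by (intro exI[of _ "e / 2"]) auto
qed

lemma padic_cauchy_inverse:
  assumes p: "prime p" and X: "padic_cauchy p X" and nz: "\<not> padic_null p X"
  shows "padic_cauchy p (\<lambda>n. inverse (X n))"
  unfolding padic_cauchy_def
proof (intro allI impI)
  fix e :: real assume e: "e > 0"
  obtain b M where b: "b > 0" and M: "\<forall>n\<ge>M. padic_abs p (X n) \<ge> b"
    using padic_cauchy_not_null[OF assms] by blast
  obtain N where N: "\<forall>m\<ge>N. \<forall>n\<ge>N. padic_abs p (X m - X n) < e * b\<^sup>2"
    using padic_cauchyD[OF X, of "e * b\<^sup>2"] e b by auto
  have "padic_abs p (inverse (X m) - inverse (X n)) < e"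
    if mn: "m \<ge> max M N" "n \<ge> max M N" for m n
  proof -
    have bm: "padic_abs p (X m) \<ge> b" and bn: "padic_abs p (X n) \<ge> b" using M mn by auto
    hence "X m \<noteq> 0" "X n \<noteq> 0" using b by auto
    hence "inverse (X m) - inverse (X n) = (X n - X m) * inverse (X m) * inverse (X n)"
      by (simp add: field_simps)
    hence "padic_abs p (inverse (X m) - inverse (X n))
        = padic_abs p (X m - X n) * inverse (padic_abs p (X m) * padic_abs p (X n))"
      by (simp add: padic_abs_mult[OF p] padic_abs_inverse[OF p]
          padic_abs_minus_commute[OF p, of "X n"])
    also have "\<dots> \<le> padic_abs p (X m - X n) * inverse (b * b)"
      using b bm bn
      by (intro mult_left_mono le_imp_inverse_le mult_mono padic_abs_ge_0[OF p]) auto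
    also have "\<dots> < e * b\<^sup>2 * inverse (b * b)"
      using N mn b by (intro mult_strict_right_mono) auto
    also have "\<dots> = e" using b by (simp add: power2_eq_square field_simps)
    finally show ?thesis .
  qed
  thus "\<exists>N. \<forall>m\<ge>N. \<forall>n\<ge>N. padic_abs p (inverse (X m) - inverse (X n)) < e" by blast
qed


section \<open>The field of \<open>p\<close>-adic numbers\<close>

definition padic_rel :: "nat \<Rightarrow> (nat \<Rightarrow> rat) \<Rightarrow> (nat \<Rightarrow> rat) \<Rightarrow> bool" where
  "padic_rel p X Y \<longleftrightarrow> padic_cauchy p X \<and> padic_cauchy p Y \<and> padic_null p (\<lambda>n. X n - Y n)"

lemma part_equivp_padic_rel:
  assumes p: "prime p" shows "part_equivp (padic_rel p)"
proof (rule part_equivpI)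
  show "\<exists>X. padic_rel p X X"
    by (rule exI[of _ "\<lambda>n. 0"]) (simp add: padic_rel_def)
  show "symp (padic_rel p)"
    using padic_null_minus_commute[OF p] by (intro sympI) (unfold padic_rel_def, blast)
  show "transp (padic_rel p)"
  proof (rule transpI)
    fix X Y Z assume "padic_rel p X Y" "padic_rel p Y Z"
    thus "padic_rel p X Z"
      using padic_null_add[OF p, of "\<lambda>n. X n - Y n" "\<lambda>n. Y n - Z n"]
      by (auto simp: padic_rel_def)
  qed
qed

text \<open>The completion of the rationals with respect to \<open>padic_abs p\<close>: Cauchy sequences modulo
  null sequences.  The prime \<open>p\<close> is the cardinality of the type parameter.\<close>

typedef (overloaded) 'a padic =
  "{Collect (padic_rel CARD('a::prime_card) X) | X. padic_cauchy CARD('a) X}"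
  using padic_cauchy_const by blast

definition padic_of_seq :: "(nat \<Rightarrow> rat) \<Rightarrow> 'a::prime_card padic" where
  "padic_of_seq X = Abs_padic (Collect (padic_rel CARD('a) X))"

definition seq_of_padic :: "'a::prime_card padic \<Rightarrow> nat \<Rightarrow> rat" where
  "seq_of_padic x = (SOME X. X \<in> Rep_padic x)"

definition cr_padic :: "(nat \<Rightarrow> rat) \<Rightarrow> 'a::prime_card padic \<Rightarrow> bool" where
  "cr_padic X x \<longleftrightarrow> padic_rel CARD('a) X X \<and> padic_of_seq X = x"

lemma padic_rel_refl_iff: "padic_rel p X X \<longleftrightarrow> padic_cauchy p X"
  by (simp add: padic_rel_def)

lemma Quotient_padic:
  "Quotient (padic_rel CARD('a::prime_card)) (padic_of_seq :: _ \<Rightarrow> 'a padic) seq_of_padic cr_padic"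
proof -
  let ?R = "padic_rel CARD('a)"
  have R: "part_equivp ?R" by (rule part_equivp_padic_rel[OF prime_card])
  have Rep_of_seq: "Rep_padic (padic_of_seq X :: 'a padic) = Collect (?R X)" if "?R X X" for X
    unfolding padic_of_seq_def using that
    by (intro Abs_padic_inverse) (auto simp: padic_rel_refl_iff)
  have of_seq_eq: "(padic_of_seq X :: 'a padic) = padic_of_seq Y \<longleftrightarrow> ?R X Y"
    if "?R X X" "?R Y Y" for X Y
  proof -
    have "(padic_of_seq X :: 'a padic) = padic_of_seq Y \<longleftrightarrow> Collect (?R X) = Collect (?R Y)"
      using Rep_of_seq that by (metis Rep_padic_inject)
    also have "\<dots> \<longleftrightarrow> ?R X Y"
      using that part_equivp_symp[OF R] part_equivp_transp[OF R] by blast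
    finally show ?thesis .
  qed
  have seq: "?R (seq_of_padic x) (seq_of_padic x) \<and> padic_of_seq (seq_of_padic x) = x"
    for x :: "'a padic"
  proof -
    obtain X where X: "?R X X" "Rep_padic x = Collect (?R X)"
      using Rep_padic[of x] by (auto simp: padic_rel_refl_iff)
    have x: "x = padic_of_seq X"
      using X(2) unfolding padic_of_seq_def by (metis Rep_padic_inverse)
    have "?R X (seq_of_padic x)"
      unfolding seq_of_padic_def X(2) using someI[of "?R X" X] X(1) by simp
    moreover from this have "?R (seq_of_padic x) (seq_of_padic x)"
      using part_equivp_symp[OF R] part_equivp_transp[OF R] by blast
    ultimately show ?thesis using of_seq_eq X(1) x by metis
  qed
  have rel: "?R X Y \<longleftrightarrow> ?R X X \<and> ?R Y Y \<and> (padic_of_seq X :: 'a padic) = padic_of_seq Y" for X Y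
    using of_seq_eq[of X Y] by (auto simp: padic_rel_def)
  show ?thesis
    unfolding Quotient_def
  proof (intro conjI allI)
    show "cr_padic = (\<lambda>X x. ?R X X \<and> (padic_of_seq X :: 'a padic) = x)"
      by (simp add: cr_padic_def fun_eq_iff)
  qed (use seq in simp, use seq in simp, rule rel)
qed

setup_lifting Quotient_padic

instantiation padic :: (prime_card) field
begin

lift_definition zero_padic :: "'a padic" is "\<lambda>n. 0"
  by (simp add: padic_rel_def)

lift_definition one_padic :: "'a padic" is "\<lambda>n. 1"
  by (simp add: padic_rel_def)

lift_definition plus_padic :: "'a padic \<Rightarrow> 'a padic \<Rightarrow> 'a padic" is "\<lambda>X Y n. X n + Y n"
proof -
  fix X X' Y Y' :: "nat \<Rightarrow> rat"
  assume "padic_rel CARD('a) X X'" "padic_rel CARD('a) Y Y'"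
  thus "padic_rel CARD('a) (\<lambda>n. X n + Y n) (\<lambda>n. X' n + Y' n)"
    using padic_null_add[OF prime_card, of "\<lambda>n. X n - X' n" "\<lambda>n. Y n - Y' n"]
    by (auto simp: padic_rel_def padic_cauchy_add[OF prime_card] algebra_simps)
qed

lift_definition uminus_padic :: "'a padic \<Rightarrow> 'a padic" is "\<lambda>X n. - X n"
proof -
  fix X X' :: "nat \<Rightarrow> rat"
  assume "padic_rel CARD('a) X X'"
  thus "padic_rel CARD('a) (\<lambda>n. - X n) (\<lambda>n. - X' n)"
    using padic_null_uminus[OF prime_card, of "\<lambda>n. X n - X' n"]
    by (auto simp: padic_rel_def padic_cauchy_uminus[OF prime_card])
qed

lift_definition times_padic :: "'a padic \<Rightarrow> 'a padic \<Rightarrow> 'a padic" is "\<lambda>X Y n. X n * Y n"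
proof -
  fix X X' Y Y' :: "nat \<Rightarrow> rat"
  assume *: "padic_rel CARD('a) X X'" "padic_rel CARD('a) Y Y'"
  have "padic_null CARD('a) (\<lambda>n. X n * (Y n - Y' n) + Y' n * (X n - X' n))"
    using * by (intro padic_null_add padic_null_mult prime_card) (auto simp: padic_rel_def)
  thus "padic_rel CARD('a) (\<lambda>n. X n * Y n) (\<lambda>n. X' n * Y' n)"
    using * by (auto simp: padic_rel_def padic_cauchy_mult[OF prime_card] algebra_simps)
qed

lift_definition inverse_padic :: "'a padic \<Rightarrow> 'a padic"
  is "\<lambda>X. if padic_null CARD('a) X then (\<lambda>n. 0) else (\<lambda>n. inverse (X n))"
proof -
  fix X Y :: "nat \<Rightarrow> rat"
  let ?p = "CARD('a)"
  have p: "prime ?p" by (rule prime_card)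
  assume "padic_rel ?p X Y"
  hence X: "padic_cauchy ?p X" and Y: "padic_cauchy ?p Y"
    and XY: "padic_null ?p (\<lambda>n. X n - Y n)" by (auto simp: padic_rel_def)
  have YX: "padic_null ?p (\<lambda>n. Y n - X n)" using XY padic_null_minus_commute[OF p] by blast
  have iff: "padic_null ?p X \<longleftrightarrow> padic_null ?p Y"
    using padic_null_add[OF p XY, of Y] padic_null_add[OF p YX, of X] by auto
  show "padic_rel ?p (if padic_null ?p X then (\<lambda>n. 0) else (\<lambda>n. inverse (X n)))
                     (if padic_null ?p Y then (\<lambda>n. 0) else (\<lambda>n. inverse (Y n)))"
  proof (cases "padic_null ?p X")
    case True
    thus ?thesis using iff by (simp add: padic_rel_def)
  next
    case False
    hence nX: "\<not> padic_null ?p X" and nY: "\<not> padic_null ?p Y" using iff by auto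
    note iX = padic_cauchy_inverse[OF p X nX] and iY = padic_cauchy_inverse[OF p Y nY]
    obtain b M where b: "b > 0" "\<forall>n\<ge>M. padic_abs ?p (X n) \<ge> b"
      using padic_cauchy_not_null[OF p X nX] by blast
    obtain c N where c: "c > 0" "\<forall>n\<ge>N. padic_abs ?p (Y n) \<ge> c"
      using padic_cauchy_not_null[OF p Y nY] by blast
    let ?Z = "\<lambda>n. inverse (X n) * inverse (Y n) * (Y n - X n)"
    have Z: "padic_null ?p ?Z"
      by (intro padic_null_mult padic_cauchy_mult p iX iY YX)
    have ev: "eventually (\<lambda>n. padic_abs ?p (?Z n)
                             = padic_abs ?p (inverse (X n) - inverse (Y n))) sequentially"
      using eventually_ge_at_top[of "max M N"]
    proof eventually_elim
      case (elim n)
      hence "padic_abs ?p (X n) \<ge> b" "padic_abs ?p (Y n) \<ge> c" using b c by auto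
      hence "X n \<noteq> 0" "Y n \<noteq> 0" using b c by auto
      hence "?Z n = inverse (X n) - inverse (Y n)" by (simp add: field_simps)
      thus ?case by simp
    qed
    have "padic_null ?p (\<lambda>n. inverse (X n) - inverse (Y n))"
      using Z unfolding padic_null_def by (rule Lim_transform_eventually[OF _ ev])
    thus ?thesis using nX nY iX iY by (simp add: padic_rel_def)
  qed
qed

definition minus_padic :: "'a padic \<Rightarrow> 'a padic \<Rightarrow> 'a padic" where
  "minus_padic x y = x + - y"

definition divide_padic :: "'a padic \<Rightarrow> 'a padic \<Rightarrow> 'a padic" where
  "divide_padic x y = x * inverse y"

instance
proof
  fix a b c :: "'a padic"
  let ?p = "CARD('a)"
  have p: "prime ?p" by (rule prime_card)
  note cs = padic_cauchy_add[OF p] padic_cauchy_mult[OF p] padic_cauchy_uminus[OF p]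
  show "a * b * c = a * (b * c)"
    by transfer (auto simp: padic_rel_def cs algebra_simps)
  show "a * b = b * a"
    by transfer (auto simp: padic_rel_def cs algebra_simps)
  show "1 * a = a"
    by transfer (auto simp: padic_rel_def cs)
  show "a + b + c = a + (b + c)"
    by transfer (auto simp: padic_rel_def cs algebra_simps)
  show "a + b = b + a"
    by transfer (auto simp: padic_rel_def cs algebra_simps)
  show "0 + a = a"
    by transfer (auto simp: padic_rel_def cs)
  show "- a + a = 0"
    by transfer (auto simp: padic_rel_def cs)
  show "a - b = a + - b"
    by (simp add: minus_padic_def)
  show "(a + b) * c = a * c + b * c"
    by transfer (auto simp: padic_rel_def cs algebra_simps)
  show "(0 :: 'a padic) \<noteq> 1"
    by transfer (simp add: padic_rel_def padic_null_def padic_abs_uminus[OF p] LIMSEQ_const_iff)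
  show "a div b = a * inverse b"
    by (simp add: divide_padic_def)
  show "inverse (0 :: 'a padic) = 0"
    by transfer (simp add: padic_rel_def)
  show "a \<noteq> 0 \<Longrightarrow> inverse a * a = 1"
  proof transfer
    fix X :: "nat \<Rightarrow> rat"
    assume "padic_rel ?p X X" and n0: "\<not> padic_rel ?p X (\<lambda>n. 0)"
    hence X: "padic_cauchy ?p X" and nX: "\<not> padic_null ?p X" by (auto simp: padic_rel_def)
    obtain b M where b: "b > 0" "\<forall>n\<ge>M. padic_abs ?p (X n) \<ge> b"
      using padic_cauchy_not_null[OF p X nX] by blast
    have "eventually (\<lambda>n. 0 = padic_abs ?p (inverse (X n) * X n - 1)) sequentially"
      using eventually_ge_at_top[of M]
    proof eventually_elim
      case (elim n)
      hence "padic_abs ?p (X n) \<ge> b" using b by auto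
      hence "X n \<noteq> 0" using b by auto
      thus ?case by simp
    qed
    hence "padic_null ?p (\<lambda>n. inverse (X n) * X n - 1)"
      unfolding padic_null_def by (rule Lim_transform_eventually[OF tendsto_const])
    thus "padic_rel ?p (\<lambda>n. (if padic_null ?p X then (\<lambda>n. 0) else (\<lambda>n. inverse (X n))) n * X n) (\<lambda>n. 1)"
      using nX X padic_cauchy_inverse[OF p X nX] by (simp add: padic_rel_def cs)
  qed
qed

end


section \<open>Numbers of nonzero roots of fewnomials\<close>

definition fewnomials :: "nat \<Rightarrow> 'a::field poly set" where
  "fewnomials t = {f. f \<noteq> 0 \<and> card {i. Polynomial.coeff f i \<noteq> 0} \<le> t + 1}"

definition B1 :: "nat \<Rightarrow> 'a::field itself \<Rightarrow> enat" where
  "B1 t K = (SUP f \<in> (fewnomials t :: 'a poly set).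
     enat (card {x. x \<noteq> 0 \<and> poly f x = 0}))"

definition Bm :: "nat \<Rightarrow> 'a::field itself \<Rightarrow> enat" where
  "Bm t K = (SUP f \<in> (fewnomials t :: 'a poly set).
     enat (\<Sum>x | x \<noteq> 0 \<and> poly f x = 0. Polynomial.order x f))"

end

theory Submission
  imports Defs
begin

text \<open>
  Let \<open>f = A + B x ^ m + C x ^ n\<close> with \<open>0 < m < n\<close>.  For the upper bound, the nonzero zeros of \<open>f\<close> are
  sorted by norm and then by residue, so that each sphere \<open>\<bar>x\<bar> = r\<close> splits into \<open>p - 1\<close> residue discs
  \<open>x (1 + p z)\<close>, \<open>\<bar>z\<bar> \<le> 1\<close>.  By Strassmann's argument (\<open>dominant_index_ge_sum_order\<close>) the number of
  zeros in such a disc is at most the last index at which the Taylor coefficients \<open>c k\<close> of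
  \<open>f (x (1 + p z))\<close> attain their maximal norm.  Up to a factor \<open>p ^ (k - 2) / k!\<close> every \<open>c k\<close> with
  \<open>k \<ge> 3\<close> is an integral combination of \<open>p c 1\<close> and \<open>c 2\<close>, because on the two exponents all falling
  factorials reduce to the first two (\<open>falling_factorial_combination\<close>); for \<open>p \<ge> 5\<close> this factor is
  small, so a disc contains at most two zeros, counted with multiplicity.

  By the Newton polygon the zeros lie on at most two spheres.  If there are two, the terms of exponents
  \<open>0\<close> and \<open>m\<close> dominate on the smaller sphere and those of exponents \<open>m\<close> and \<open>n\<close> on the larger one
  (\<open>dominant_terms_of_two_norms\<close>).  A disc with two zeros forces \<open>\<bar>m\<bar> < \<bar>n\<bar>\<close> on the smaller sphere and
  \<open>\<bar>n - m\<bar> < \<bar>n\<bar>\<close> on the larger one (\<open>two_zeros_inner_disc\<close>, \<open>two_zeros_outer_disc\<close>).  As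
  \<open>\<bar>n\<bar> \<le> max \<bar>m\<bar> \<bar>n - m\<bar>\<close>, such discs cannot occur on both spheres, and the total is at most
  \<open>2 (p - 1) + (p - 1)\<close>.

  The bound is attained by a trinomial in \<open>z = x ^ (p - 1)\<close> with three simple zeros \<open>z\<close>, each of which
  has \<open>p - 1\<close> roots of order \<open>p - 1\<close>: two zeros congruent to \<open>1\<close>, sharing a residue disc, and one of
  norm \<open>p\<close> to the power \<open>- (p - 1)\<close> (\<open>fewnomial_many_roots\<close>).  The roots come from Hensel's lemma.
\<close>

section \<open>The norm on the \<open>p\<close>-adic numbers\<close>

lemma padic_abs_diff_le:
  assumes p: "prime p" shows "\<bar>padic_abs p x - padic_abs p y\<bar> \<le> padic_abs p (x - y)"
  using padic_abs_triangle[OF p, of "x - y" y] padic_abs_triangle[OF p, of "y - x" x]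
    padic_abs_minus_commute[OF p, of x y] by simp

lemma convergent_padic_abs:
  assumes p: "prime p" and X: "padic_cauchy p X"
  shows "convergent (\<lambda>n. padic_abs p (X n))"
proof (rule Cauchy_convergent, rule metric_CauchyI)
  fix e :: real assume "e > 0"
  then obtain N where N: "\<forall>m\<ge>N. \<forall>n\<ge>N. padic_abs p (X m - X n) < e"
    using padic_cauchyD[OF X] by blast
  have "dist (padic_abs p (X m)) (padic_abs p (X n)) < e" if "m \<ge> N" "n \<ge> N" for m n
    using padic_abs_diff_le[OF p, of "X m" "X n"] N that
    unfolding dist_real_def by (meson le_less_trans)
  thus "\<exists>N. \<forall>m\<ge>N. \<forall>n\<ge>N. dist (padic_abs p (X m)) (padic_abs p (X n)) < e" by blast
qed

lift_definition padic_norm :: "'a::prime_card padic \<Rightarrow> real"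
  is "\<lambda>X. lim (\<lambda>n. padic_abs CARD('a) (X n))"
proof -
  fix X Y :: "nat \<Rightarrow> rat"
  let ?p = "CARD('a)"
  assume "padic_rel ?p X Y"
  hence X: "padic_cauchy ?p X" and XY: "padic_null ?p (\<lambda>n. X n - Y n)"
    by (auto simp: padic_rel_def)
  have "(\<lambda>n. padic_abs ?p (X n)) \<longlonglongrightarrow> lim (\<lambda>n. padic_abs ?p (X n))"
    using convergent_padic_abs[OF prime_card X] by (simp add: convergent_LIMSEQ_iff)
  moreover have "(\<lambda>n. padic_abs ?p (Y n) - padic_abs ?p (X n)) \<longlonglongrightarrow> 0"
  proof (rule tendsto_0_le[where K = 1])
    show "\<forall>\<^sub>F n in sequentially. norm (padic_abs ?p (Y n) - padic_abs ?p (X n))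
            \<le> norm (padic_abs ?p (X n - Y n)) * 1"
      using padic_abs_diff_le[OF prime_card[where 'a='a]] padic_abs_ge_0[OF prime_card[where 'a='a]]
      by (auto simp: abs_minus_commute)
    show "(\<lambda>n. padic_abs ?p (X n - Y n)) \<longlonglongrightarrow> 0"
      using XY by (simp add: padic_null_def)
  qed
  ultimately have "(\<lambda>n. padic_abs ?p (Y n)) \<longlonglongrightarrow> lim (\<lambda>n. padic_abs ?p (X n))"
    using tendsto_add by fastforce
  thus "lim (\<lambda>n. padic_abs ?p (X n)) = lim (\<lambda>n. padic_abs ?p (Y n))"
    by (simp add: limI)
qed

lemma padic_of_seq_cases:
  obtains X where "padic_cauchy CARD('a) X" "(x :: 'a::prime_card padic) = padic_of_seq X"
  using Quotient_rep_reflp[OF Quotient_padic[where 'a='a], of x]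
    Quotient_abs_rep[OF Quotient_padic[where 'a='a], of x]
  by (metis padic_rel_refl_iff)

lemma tendsto_padic_norm:
  assumes X: "padic_cauchy CARD('a) X"
  shows "(\<lambda>n. padic_abs CARD('a) (X n)) \<longlonglongrightarrow> padic_norm (padic_of_seq X :: 'a::prime_card padic)"
  using convergent_padic_abs[OF prime_card X] X
  by (simp add: convergent_LIMSEQ_iff padic_norm.abs_eq padic_rel_refl_iff)

context
  fixes X Y :: "nat \<Rightarrow> rat"
  assumes X: "padic_cauchy CARD('a::prime_card) X" and Y: "padic_cauchy CARD('a) Y"
begin

lemma padic_of_seq_add:
  "padic_of_seq X + padic_of_seq Y = (padic_of_seq (\<lambda>n. X n + Y n) :: 'a padic)"
  by (rule plus_padic.abs_eq) (use X Y in \<open>simp_all add: padic_rel_refl_iff\<close>)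

lemma padic_of_seq_mult:
  "padic_of_seq X * padic_of_seq Y = (padic_of_seq (\<lambda>n. X n * Y n) :: 'a padic)"
  by (rule times_padic.abs_eq) (use X Y in \<open>simp_all add: padic_rel_refl_iff\<close>)

lemma padic_of_seq_eq_iff:
  "(padic_of_seq X :: 'a padic) = padic_of_seq Y \<longleftrightarrow> padic_null CARD('a) (\<lambda>n. X n - Y n)"
  using Quotient_rel[OF Quotient_padic[where 'a='a], of X Y] X Y by (auto simp: padic_rel_def)

end

lemma padic_of_seq_uminus:
  assumes X: "padic_cauchy CARD('a) X"
  shows "- padic_of_seq X = (padic_of_seq (\<lambda>n. - X n) :: 'a::prime_card padic)"
  by (rule uminus_padic.abs_eq) (use X in \<open>simp_all add: padic_rel_refl_iff\<close>)

lemma padic_of_seq_0: "padic_of_seq (\<lambda>n. 0) = (0 :: 'a::prime_card padic)"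
  by (rule zero_padic.abs_eq[symmetric])

lemma padic_of_seq_1: "padic_of_seq (\<lambda>n. 1) = (1 :: 'a::prime_card padic)"
  by (rule one_padic.abs_eq[symmetric])

lemma padic_of_seq_of_nat: "padic_of_seq (\<lambda>n. of_nat k) = (of_nat k :: 'a::prime_card padic)"
proof (induction k)
  case (Suc k)
  have "(of_nat (Suc k) :: 'a padic) = padic_of_seq (\<lambda>n. 1) + padic_of_seq (\<lambda>n. of_nat k)"
    by (simp add: Suc padic_of_seq_1)
  also have "\<dots> = padic_of_seq (\<lambda>n. of_nat (Suc k))"
    by (subst padic_of_seq_add) auto
  finally show ?case by simp
qed (simp add: padic_of_seq_0)

lemma padic_of_seq_of_int: "padic_of_seq (\<lambda>n. of_int k) = (of_int k :: 'a::prime_card padic)"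
proof (cases k)
  case (nonneg n)
  thus ?thesis using padic_of_seq_of_nat[of n] by simp
next
  case (neg n)
  thus ?thesis
    using padic_of_seq_uminus[of "\<lambda>_. of_nat (Suc n)", where 'a='a] padic_of_seq_of_nat[of "Suc n", where 'a='a]
    by simp
qed

lemma padic_norm_of_int:
  "padic_norm (of_int k :: 'a::prime_card padic) = padic_abs CARD('a) (of_int k)"
  using tendsto_padic_norm[of "\<lambda>_. of_int k", where 'a='a]
  by (simp add: padic_of_seq_of_int LIMSEQ_const_iff)

lemma padic_norm_of_nat:
  "padic_norm (of_nat k :: 'a::prime_card padic) = padic_abs CARD('a) (of_nat k)"
  using padic_norm_of_int[of "int k", where 'a='a] by simp

lemma padic_norm_0 [simp]: "padic_norm 0 = 0"
  using padic_norm_of_nat[of 0] by simp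

lemma padic_norm_1 [simp]: "padic_norm 1 = 1"
  using padic_norm_of_nat[of 1] by simp

lemma padic_norm_eq_0_iff [simp]: "padic_norm x = 0 \<longleftrightarrow> x = 0"
proof
  obtain X where X: "padic_cauchy CARD('a) X" "x = padic_of_seq X" by (rule padic_of_seq_cases)
  assume "padic_norm x = 0"
  hence "padic_null CARD('a) (\<lambda>n. X n - 0)"
    using tendsto_padic_norm[OF X(1)] X(2) by (simp add: padic_null_def)
  thus "x = 0" using padic_of_seq_eq_iff[OF X(1), of "\<lambda>_. 0"] X(2) by (simp add: padic_of_seq_0)
qed auto

lemma padic_norm_ge_0 [simp]: "padic_norm (x :: 'a::prime_card padic) \<ge> 0"
proof -
  obtain X where X: "padic_cauchy CARD('a) X" "x = padic_of_seq X" by (rule padic_of_seq_cases)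
  show ?thesis
    using tendsto_padic_norm[OF X(1)] X(2)
    by (auto intro!: LIMSEQ_le_const padic_abs_ge_0[OF prime_card])
qed

lemma padic_norm_pos_iff [simp]: "padic_norm x > 0 \<longleftrightarrow> x \<noteq> 0"
  using padic_norm_ge_0[of x] padic_norm_eq_0_iff[of x] by linarith

lemma padic_norm_mult: "padic_norm (x * y) = padic_norm x * padic_norm (y :: 'a::prime_card padic)"
proof -
  let ?p = "CARD('a)"
  obtain X where X: "padic_cauchy ?p X" "x = padic_of_seq X" by (rule padic_of_seq_cases)
  obtain Y where Y: "padic_cauchy ?p Y" "y = padic_of_seq Y" by (rule padic_of_seq_cases)
  have "(\<lambda>n. padic_abs ?p (X n) * padic_abs ?p (Y n)) \<longlonglongrightarrow> padic_norm x * padic_norm y"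
    unfolding X(2) Y(2) by (intro tendsto_mult tendsto_padic_norm X Y)
  moreover have "(\<lambda>n. padic_abs ?p (X n * Y n)) \<longlonglongrightarrow> padic_norm (x * y)"
    unfolding X(2) Y(2) padic_of_seq_mult[OF X(1) Y(1)]
    by (intro tendsto_padic_norm padic_cauchy_mult X Y prime_card)
  ultimately show ?thesis
    using LIMSEQ_unique by (auto simp: padic_abs_mult[OF prime_card])
qed

lemma padic_norm_add_le_max:
  "padic_norm (x + y) \<le> max (padic_norm x) (padic_norm (y :: 'a::prime_card padic))"
proof -
  let ?p = "CARD('a)"
  obtain X where X: "padic_cauchy ?p X" "x = padic_of_seq X" by (rule padic_of_seq_cases)
  obtain Y where Y: "padic_cauchy ?p Y" "y = padic_of_seq Y" by (rule padic_of_seq_cases)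
  have "(\<lambda>n. max (padic_abs ?p (X n)) (padic_abs ?p (Y n))) \<longlonglongrightarrow> max (padic_norm x) (padic_norm y)"
    unfolding X(2) Y(2) by (intro tendsto_max tendsto_padic_norm X Y)
  moreover have "(\<lambda>n. padic_abs ?p (X n + Y n)) \<longlonglongrightarrow> padic_norm (x + y)"
    unfolding X(2) Y(2) padic_of_seq_add[OF X(1) Y(1)]
    by (intro tendsto_padic_norm padic_cauchy_add X Y prime_card)
  ultimately show ?thesis
    using padic_abs_add_le_max[OF prime_card[where 'a='a]] by (meson LIMSEQ_le)
qed

lemma padic_norm_uminus [simp]: "padic_norm (- x) = padic_norm x"
proof -
  have "padic_norm (-1 :: 'a padic) = 1"
    using padic_norm_of_int[of "-1", where 'a='a] padic_abs_uminus[OF prime_card[where 'a='a], of 1] by simp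
  thus ?thesis using padic_norm_mult[of "-1" x] by simp
qed

lemma padic_norm_minus_commute: "padic_norm (x - y) = padic_norm (y - x)"
  using padic_norm_uminus[of "x - y"] by simp

lemma padic_norm_diff_le_max: "padic_norm (x - y) \<le> max (padic_norm x) (padic_norm y)"
  using padic_norm_add_le_max[of x "- y"] by simp

lemma padic_norm_add_eq_right:
  assumes "padic_norm x < padic_norm y" shows "padic_norm (x + y) = padic_norm y"
proof -
  have "padic_norm y \<le> max (padic_norm (x + y)) (padic_norm x)"
    using padic_norm_diff_le_max[of "x + y" x] by simp
  thus ?thesis using padic_norm_add_le_max[of x y] assms by linarith
qed

lemma padic_norm_power: "padic_norm (x ^ n) = padic_norm x ^ n"
  by (induction n) (simp_all add: padic_norm_mult)

lemma padic_norm_inverse: "padic_norm (inverse x) = inverse (padic_norm x)"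
proof (cases "x = 0")
  case False
  hence "padic_norm x * padic_norm (inverse x) = 1"
    using padic_norm_mult[of x "inverse x"] by simp
  thus ?thesis by (metis inverse_unique)
qed auto

lemma padic_norm_divide: "padic_norm (x / y) = padic_norm x / padic_norm y"
  by (simp add: divide_inverse padic_norm_mult padic_norm_inverse)

section \<open>Norms of integers and residues\<close>

lemma padic_norm_of_int_nonzero:
  assumes "k \<noteq> 0"
  shows "padic_norm (of_int k :: 'a::prime_card padic) = (1 / real CARD('a)) ^ multiplicity (int CARD('a)) k"
  unfolding padic_norm_of_int
  using padic_abs_of_int_divide[OF prime_card[where 'a='a] assms, of 1]
  by (simp add: power_int_minus divide_inverse power_inverse)

lemma padic_norm_of_int_le_1 [simp]: "padic_norm (of_int k :: 'a::prime_card padic) \<le> 1"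
  by (cases "k = 0")
     (auto simp: padic_norm_of_int_nonzero intro!: power_le_one)

lemma padic_norm_of_nat_le_1 [simp]: "padic_norm (of_nat k :: 'a::prime_card padic) \<le> 1"
  using padic_norm_of_int_le_1[of "int k"] by simp

lemma prime_card_gt_1: "1 < real CARD('a::prime_card)"
  using prime_gt_1_nat[OF prime_card[where 'a='a]] by simp

lemma padic_norm_of_int_le_iff:
  "padic_norm (of_int k :: 'a::prime_card padic) \<le> (1 / real CARD('a)) ^ n
     \<longleftrightarrow> int CARD('a) ^ n dvd k"
proof (cases "k = 0")
  case False
  have nu: "\<not> is_unit (int CARD('a))" using prime_card_int[where 'a='a] not_prime_unit by blast
  have "padic_norm (of_int k :: 'a padic) \<le> (1 / real CARD('a)) ^ n
      \<longleftrightarrow> n \<le> multiplicity (int CARD('a)) k"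
    unfolding padic_norm_of_int_nonzero[OF False]
    using prime_card_gt_1[where 'a='a] by (intro power_decreasing_iff) auto
  also have "\<dots> \<longleftrightarrow> int CARD('a) ^ n dvd k"
    using False nu by (subst power_dvd_iff_le_multiplicity) auto
  finally show ?thesis .
qed auto

lemma padic_norm_of_int_eq_1_iff:
  "padic_norm (of_int k :: 'a::prime_card padic) = 1 \<longleftrightarrow> \<not> int CARD('a) dvd k"
proof
  assume "padic_norm (of_int k :: 'a padic) = 1"
  thus "\<not> int CARD('a) dvd k"
    using padic_norm_of_int_le_iff[of k 1, where 'a='a] prime_card_gt_1[where 'a='a] by auto
next
  assume *: "\<not> int CARD('a) dvd k"
  hence "k \<noteq> 0" by auto
  thus "padic_norm (of_int k :: 'a padic) = 1"
    using * by (simp add: padic_norm_of_int_nonzero not_dvd_imp_multiplicity_0)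
qed

lemma padic_norm_prime: "padic_norm (of_nat CARD('a) :: 'a::prime_card padic) = 1 / real CARD('a)"
  using padic_norm_of_int_nonzero[of "int CARD('a)", where 'a='a] prime_card_int[where 'a='a]
  by (simp add: multiplicity_prime)

lemma of_nat_padic_eq_0_iff [simp]: "(of_nat k :: 'a::prime_card padic) = 0 \<longleftrightarrow> k = 0"
proof
  assume *: "(of_nat k :: 'a padic) = 0"
  show "k = 0"
    using padic_abs_pos[OF prime_card[where 'a='a], of "of_nat k"] padic_norm_of_nat[of k, where 'a='a] *
    by (cases "k = 0") auto
qed auto

lemma padic_abs_less_1_imp:
  assumes p: "prime p" and "padic_abs p x < 1" shows "padic_abs p x \<le> 1 / real p"
proof (cases "x = 0")
  case False
  obtain a b where "quotient_of x = (a, b)" by force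
  then obtain e :: int where e: "padic_abs p x = real p powi e"
    using False by (auto simp: padic_abs_def)
  have p1: "real p > 1" using prime_gt_1_nat[OF p] by simp
  have "e < 0"
    using assms(2) p1 one_le_power_int[of "real p" e] unfolding e by (meson not_le less_imp_le)
  hence "real p powi e \<le> real p powi (-1)" using p1 by (intro power_int_increasing) auto
  thus ?thesis by (simp add: e divide_inverse)
qed auto

text \<open>Every norm is a limit of values of \<open>padic_abs\<close>, and these lie in the discrete set of powers of
  \<open>p\<close> together with \<open>0\<close>.  Discreteness turns the open unit ball into the closed ball
  \<open>p\<int>\<^sub>p\<close>; that is what makes a residue class a disc \<open>x (1 + p z)\<close> with \<open>\<bar>z\<bar> \<le> 1\<close>.\<close>

lemma padic_norm_less_1_imp:
  assumes "padic_norm (x :: 'a::prime_card padic) < 1"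
  shows "padic_norm x \<le> 1 / real CARD('a)"
proof -
  let ?p = "CARD('a)"
  obtain X where X: "padic_cauchy ?p X" "x = padic_of_seq X" by (rule padic_of_seq_cases)
  note lim = tendsto_padic_norm[OF X(1), folded X(2)]
  have "eventually (\<lambda>n. padic_abs ?p (X n) < 1) sequentially"
    using order_tendstoD(2)[OF lim assms] .
  hence "eventually (\<lambda>n. padic_abs ?p (X n) \<le> 1 / real ?p) sequentially"
    by eventually_elim (rule padic_abs_less_1_imp[OF prime_card])
  thus ?thesis using tendsto_upperbound[OF lim] by simp
qed

lemma padic_abs_residue:
  assumes p: "prime p" and "padic_abs p x \<le> 1"
  obtains r where "r < p" "padic_abs p (x - of_nat r) < 1"
proof (cases "x = 0")
  case True
  thus ?thesis using that[of 0] prime_gt_0_nat[OF p] by simp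
next
  case False
  obtain a b where q: "quotient_of x = (a, b)" by force
  have b: "b > 0" and cop: "coprime a b" and x: "x = of_int a / of_int b"
    using quotient_of_denom_pos[OF q] quotient_of_coprime[OF q] quotient_of_div[OF q] by auto
  have a: "a \<noteq> 0" using False x by auto
  have p1: "real p > 1" using prime_gt_1_nat[OF p] by simp
  have pi: "prime (int p)" using p by simp
  have nd: "\<not> int p dvd b"
  proof
    assume d: "int p dvd b"
    hence "\<not> int p dvd a" using cop pi by (meson not_prime_unit coprime_common_divisor)
    hence "multiplicity (int p) a = 0" by (simp add: not_dvd_imp_multiplicity_0)
    moreover have "multiplicity (int p) b > 0"
      using d b pi by (simp add: prime_multiplicity_gt_zero_iff)
    ultimately have "padic_abs p x > 1"
      using padic_abs_of_int_divide[OF p a, of b] b p1 x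
      by (auto intro!: one_less_power)
    thus False using assms by simp
  qed
  hence "coprime b (int p)" using pi by (metis coprime_commute prime_imp_coprime)
  then obtain c where c: "[b * c = 1] (mod int p)" using cong_solve_coprime_int by blast
  define r where "r = nat ((a * c) mod int p)"
  have r: "int r = (a * c) mod int p" using prime_gt_0_nat[OF p] by (simp add: r_def)
  have rp: "r < p" using prime_gt_0_nat[OF p] r by (metis pos_mod_bound of_nat_0_less_iff of_nat_less_iff)
  have "[a - b * int r = a - b * (a * c)] (mod int p)"
    by (intro cong_diff cong_mult) (auto simp: r cong_def)
  also have "[a - b * (a * c) = a - a * (b * c)] (mod int p)"
    by (simp add: algebra_simps)
  also have "[a - a * (b * c) = a - a * 1] (mod int p)"
    by (intro cong_diff cong_mult c) auto
  finally have dv: "int p dvd a - b * int r" by (simp add: cong_0_iff)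
  have "padic_abs p (x - of_nat r) < 1"
  proof (cases "a - b * int r = 0")
    case True
    hence "x - of_nat r = 0" using b x by (simp add: field_simps)
    thus ?thesis by simp
  next
    case False
    have "x - of_nat r = of_int (a - b * int r) / of_int b" using b x by (simp add: field_simps)
    hence "padic_abs p (x - of_nat r) = real p powi (int (multiplicity (int p) b) - int (multiplicity (int p) (a - b * int r)))"
      using padic_abs_of_int_divide[OF p False, of b] b by simp
    also have "multiplicity (int p) b = 0" using nd by (simp add: not_dvd_imp_multiplicity_0)
    also have "real p powi (int 0 - int (multiplicity (int p) (a - b * int r))) < 1"
      using dv False pi p1
      by (simp add: power_int_minus prime_multiplicity_gt_zero_iff inverse_less_1_iff)
    finally show ?thesis .
  qed
  thus ?thesis using that rp by blast
qed

text \<open>A far enough term of a Cauchy sequence for \<open>x\<close> is a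
  fraction whose denominator is prime to \<open>p\<close> and can be inverted modulo \<open>p\<close>.  So the integers below
  \<open>p\<close> represent all residue classes.\<close>

lemma padic_residue:
  assumes "padic_norm (x :: 'a::prime_card padic) \<le> 1"
  obtains r where "r < CARD('a)" "padic_norm (x - of_nat r) < 1"
proof -
  let ?p = "CARD('a)"
  have p: "prime ?p" by (rule prime_card)
  obtain X where X: "padic_cauchy ?p X" "x = padic_of_seq X" by (rule padic_of_seq_cases)
  note lim = tendsto_padic_norm[OF X(1), folded X(2)]
  obtain N where N: "\<forall>m\<ge>N. \<forall>n\<ge>N. padic_abs ?p (X m - X n) < 1"
    using padic_cauchyD[OF X(1), of 1] by auto
  have "padic_abs ?p (X N) \<le> 1"
  proof (rule ccontr)
    assume *: "\<not> padic_abs ?p (X N) \<le> 1"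
    have "padic_abs ?p (X N) \<le> padic_abs ?p (X n)" if "n \<ge> N" for n
    proof -
      have "padic_abs ?p (X N - X n) < 1" using N that by simp
      thus ?thesis using padic_abs_add_le_max[OF p, of "X N - X n" "X n"] * by simp
    qed
    hence "padic_abs ?p (X N) \<le> padic_norm x"
      by (intro tendsto_lowerbound[OF lim] eventually_sequentiallyI) auto
    thus False using assms * by simp
  qed
  then obtain r where r: "r < ?p" "padic_abs ?p (X N - of_nat r) < 1"
    by (rule padic_abs_residue[OF p])
  have "padic_abs ?p (X n - of_nat r) \<le> 1 / real ?p" if "n \<ge> N" for n
  proof -
    have "padic_abs ?p (X n - of_nat r) < 1"
      using padic_abs_add_le_max[OF p, of "X n - X N" "X N - of_nat r"] N that r(2)
      by (smt (verit, best) diff_add_cancel add_diff_eq max_def order_refl)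
    thus ?thesis by (rule padic_abs_less_1_imp[OF p])
  qed
  moreover have "x - of_nat r = padic_of_seq (\<lambda>n. X n + - of_nat r)"
    unfolding X(2) diff_conv_add_uminus
    by (subst padic_of_seq_add[symmetric])
       (auto simp: X padic_of_seq_uminus[symmetric] padic_of_seq_of_nat padic_cauchy_uminus[OF p])
  moreover have "padic_cauchy ?p (\<lambda>n. X n + - of_nat r)" 
    by (intro padic_cauchy_add p X) auto
  ultimately have "padic_norm (x - of_nat r) \<le> 1 / real ?p"
    using tendsto_upperbound[OF tendsto_padic_norm[of "\<lambda>n. X n + - of_nat r", where 'a='a]]
      eventually_sequentiallyI[of N] by simp
  also have "\<dots> < 1" using prime_card_gt_1[where 'a='a] by simp
  finally show ?thesis using that r by blast
qed

section \<open>Zeros in a disc\<close>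

text \<open>The abscissa of the right end of the horizontal edge of the Newton polygon: over an
  algebraically closed field it is the number of zeros in the closed unit disc.\<close>

definition dominant_index :: "nat \<Rightarrow> 'a::prime_card padic poly \<Rightarrow> bool" where
  "dominant_index j g \<longleftrightarrow>
     (\<forall>i. padic_norm (coeff g i) \<le> padic_norm (coeff g j)) \<and>
     (\<forall>i>j. padic_norm (coeff g i) < padic_norm (coeff g j))"

lemma dominant_index_exists:
  assumes "g \<noteq> 0" shows "\<exists>j. dominant_index j g"
proof -
  let ?N = "\<lambda>i. padic_norm (coeff g i)"
  define M where "M = Max (?N ` {..degree g})"
  have le: "?N i \<le> M" if "i \<le> degree g" for i
    unfolding M_def using that by (intro Max_ge) auto
  have Mpos: "M > 0" using le[of "degree g"] assms
    by (metis leading_coeff_0_iff order_refl padic_norm_pos_iff less_le_trans)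
  have "M \<in> ?N ` {..degree g}" unfolding M_def by (intro Max_in) auto
  define J where "J = {i. i \<le> degree g \<and> ?N i = M}"
  have J: "finite J" "J \<noteq> {}" using \<open>M \<in> _\<close> by (auto simp: J_def)
  have J': "Max J \<in> J" using Max_in[OF J] .
  have le': "?N i \<le> M" for i
    using le[of i] Mpos by (cases "i \<le> degree g") (auto simp: coeff_eq_0)
  have "?N i < M" if "i > Max J" for i
  proof (cases "i \<le> degree g")
    case True
    have "i \<notin> J" using that J by (meson Max_ge not_le)
    thus ?thesis using le[OF True] True by (auto simp: J_def)
  qed (use Mpos in \<open>auto simp: coeff_eq_0\<close>)
  thus ?thesis using le' J' unfolding dominant_index_def J_def by (metis (mono_tags, lifting) mem_Collect_eq)
qed

text \<open>Multiplying by a linear factor with a zero in the closed unit disc adds one to the index: in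
  degree \<open>j + 1\<close> the product of \<open>d\<close> with the dominant coefficient of \<open>h\<close> strictly beats
  the product of \<open>b\<close> with the next one, and no other coefficient exceeds it.\<close>

lemma dominant_index_linear_mult:
  assumes h: "dominant_index j h" and "h \<noteq> 0" and bd: "padic_norm b \<le> padic_norm d" and d: "d \<noteq> 0"
  shows "dominant_index (Suc j) ([:b, d:] * h)"
proof -
  let ?N = "\<lambda>i. padic_norm (coeff h i)" and ?g = "[:b, d:] * h"
  have le: "?N i \<le> ?N j" for i
    using h by (auto simp: dominant_index_def)
  have lt: "j < i \<Longrightarrow> ?N i < ?N j" for i
    using h by (auto simp: dominant_index_def)
  have dpos: "padic_norm d > 0" using d by simp
  have c0: "coeff ?g 0 = b * coeff h 0" by simp
  have cS: "coeff ?g (Suc i) = b * coeff h (Suc i) + d * coeff h i" for i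
    by (simp add: coeff_pCons)
  have b: "padic_norm (b * coeff h i) \<le> padic_norm d * ?N i" for i
    unfolding padic_norm_mult by (intro mult_right_mono bd) auto
  have top: "padic_norm (coeff ?g (Suc j)) = padic_norm d * ?N j"
  proof -
    have "padic_norm (b * coeff h (Suc j)) < padic_norm (d * coeff h j)"
      using b[of "Suc j"] mult_strict_left_mono[OF lt[of "Suc j"] dpos] by (simp add: padic_norm_mult)
    thus ?thesis unfolding cS by (simp add: padic_norm_add_eq_right padic_norm_mult)
  qed
  have "padic_norm (coeff ?g i) \<le> padic_norm d * ?N j" for i
  proof (cases i)
    case 0
    thus ?thesis using b[of 0] mult_left_mono[OF le[of 0], of "padic_norm d"] by (simp add: c0)
  next
    case (Suc k)
    thus ?thesis
      using b[of i] mult_left_mono[OF le[of i], of "padic_norm d"] mult_left_mono[OF le[of k], of "padic_norm d"]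
        padic_norm_add_le_max[of "b * coeff h (Suc k)" "d * coeff h k"]
      by (auto simp: cS padic_norm_mult)
  qed
  moreover have "padic_norm (coeff ?g i) < padic_norm d * ?N j" if "i > Suc j" for i
  proof -
    obtain k where k: "i = Suc k" "k > j" using \<open>i > Suc j\<close> by (cases i) auto
    show ?thesis
      using b[of i] mult_strict_left_mono[OF lt[of i] dpos] mult_strict_left_mono[OF lt[of k] dpos]
        padic_norm_add_le_max[of "b * coeff h (Suc k)" "d * coeff h k"] k
      by (auto simp: cS padic_norm_mult)
  qed
  ultimately show ?thesis unfolding dominant_index_def top by blast
qed

lemma split_off_roots:
  fixes f :: "'a::field poly"
  assumes "finite S" "f \<noteq> 0"
  shows "\<exists>h. f = (\<Prod>x\<in>S. [:-x, 1:] ^ order x f) * h"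
  using assms(1)
proof (induction S)
  case (insert x S)
  define P where "P = (\<Prod>x\<in>S. [:-x, 1:] ^ order x f)"
  from insert obtain h where h: "f = P * h" by (auto simp: P_def)
  have "poly P x \<noteq> 0" using insert by (auto simp: P_def poly_prod)
  hence "order x f = order x h"
    using h assms(2) by (metis order_mult order_0I add_0)
  hence "[:-x, 1:] ^ order x f dvd h" by (simp add: order_1)
  then obtain h' where h': "h = [:-x, 1:] ^ order x f * h'" by (rule dvdE)
  have "f = P * ([:-x, 1:] ^ order x f * h')" using h h' by metis
  also have "\<dots> = (\<Prod>x\<in>insert x S. [:-x, 1:] ^ order x f) * h'"
    unfolding P_def prod.insert[OF insert.hyps(1,2)] by (simp only: mult_ac)
  finally show ?case by blast
qed auto

text \<open>Strassmann's bound for polynomials, with multiplicities.  Only one inequality holds in general,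
  because zeros in an extension field also count towards the dominant index.  The substitution
  \<open>a + d z\<close> maps the unit disc onto the disc in question.\<close>

lemma dominant_index_ge_sum_order:
  fixes f :: "'a::prime_card padic poly"
  assumes f: "f \<noteq> 0" and S: "finite S" and d: "d \<noteq> 0"
    and disc: "\<And>x. x \<in> S \<Longrightarrow> padic_norm (x - a) \<le> padic_norm d"
  shows "\<exists>j \<ge> (\<Sum>x\<in>S. order x f). dominant_index j (f \<circ>\<^sub>p [:a, d:])"
proof -
  obtain h where h: "f = (\<Prod>x\<in>S. [:-x, 1:] ^ order x f) * h"
    using split_off_roots[OF S f] by blast
  have inj: "(g \<circ>\<^sub>p [:a, d:] = 0) = (g = 0)" for g :: "'a padic poly"
    using d by (simp add: pcompose_eq_0_iff)
  have "h \<noteq> 0" using h f by auto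
  hence h0: "h \<circ>\<^sub>p [:a, d:] \<noteq> 0" using inj by blast
  have pow: "\<exists>j' \<ge> j + n. dominant_index j' ([:a - x, d:] ^ n * g)"
    if "dominant_index j g" "g \<noteq> 0" "x \<in> S" for j n g x
  proof (induction n)
    case (Suc n)
    then obtain j' where j': "j' \<ge> j + n" "dominant_index j' ([:a - x, d:] ^ n * g)" by blast
    have "dominant_index (Suc j') ([:a - x, d:] * ([:a - x, d:] ^ n * g))"
      using disc[OF that(3)] d that(2)
      by (intro dominant_index_linear_mult j') (auto simp: padic_norm_minus_commute[of a])
    thus ?case using j' by (intro exI[of _ "Suc j'"]) (auto simp: mult_ac)
  qed (use that in auto)
  have "\<exists>j \<ge> (\<Sum>x\<in>T. n x). dominant_index j ((\<Prod>x\<in>T. [:a - x, d:] ^ n x) * (h \<circ>\<^sub>p [:a, d:]))"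
    if "T \<subseteq> S" for T and n :: "'a padic \<Rightarrow> nat"
    using finite_subset[OF that S] that
  proof (induction T)
    case empty
    thus ?case using dominant_index_exists[OF h0] by auto
  next
    case (insert x T)
    let ?g = "(\<Prod>x\<in>T. [:a - x, d:] ^ n x) * (h \<circ>\<^sub>p [:a, d:])"
    from insert obtain j where j: "j \<ge> (\<Sum>x\<in>T. n x)" "dominant_index j ?g" by auto
    have "?g \<noteq> 0" using h0 d insert by auto
    then obtain j' where "j' \<ge> j + n x" "dominant_index j' ([:a - x, d:] ^ n x * ?g)"
      using pow[OF j(2), of x "n x"] insert.prems by blast
    thus ?case using j insert by (intro exI[of _ j']) (auto simp: mult_ac)
  qed
  from this[OF order_refl, of "\<lambda>x. order x f"] obtain j where
    j: "j \<ge> (\<Sum>x\<in>S. order x f)"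
      "dominant_index j ((\<Prod>x\<in>S. [:a - x, d:] ^ order x f) * (h \<circ>\<^sub>p [:a, d:]))" by blast
  have "f \<circ>\<^sub>p [:a, d:] = (\<Prod>x\<in>S. [:a - x, d:] ^ order x f) * (h \<circ>\<^sub>p [:a, d:])"
    by (subst h) (simp add: pcompose_mult pcompose_prod pcompose_hom.hom_power pcompose_pCons)
  thus ?thesis using j by auto
qed

section \<open>Factorials and falling factorials\<close>

text \<open>Legendre's recursion: among \<open>1, \<dots>, k\<close> the multiples of \<open>p\<close> are \<open>p\<close> times
  \<open>1, \<dots>, k div p\<close>.\<close>

lemma multiplicity_fact_div:
  assumes p: "prime (p::nat)"
  shows "multiplicity p (fact k) = k div p + multiplicity p (fact (k div p) :: nat)"
proof (induction k)
  case (Suc k)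
  have p0: "p > 0" using prime_gt_0_nat[OF p] .
  have pe: "prime_elem p" using p by simp
  have fs: "multiplicity p (fact (Suc n) :: nat) = multiplicity p (Suc n) + multiplicity p (fact n :: nat)" for n
    unfolding fact_Suc using pe by (subst prime_elem_multiplicity_mult_distrib) auto
  show ?case
  proof (cases "p dvd Suc k")
    case True
    then obtain q where q: "Suc k = p * q" by (auto elim: dvdE)
    have q0: "q > 0" using q by (cases q) auto
    then obtain q' where q': "q = Suc q'" by (cases q) auto
    have kd: "k div p = q'"
      by (rule div_nat_eqI) (use q q' p0 in auto)
    have "multiplicity p (Suc k) = 1 + multiplicity p q"
      unfolding q using pe q0 p0 p not_prime_unit
      by (subst prime_elem_multiplicity_mult_distrib) (auto simp: multiplicity_prime)
    moreover have "Suc k div p = q" using q p0 by simp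
    ultimately show ?thesis using Suc fs[of k] fs[of q'] kd q' by simp
  next
    case False
    hence "multiplicity p (Suc k) = 0" by (simp add: not_dvd_imp_multiplicity_0)
    moreover have "Suc k div p = k div p"
      using False by (simp add: div_Suc mod_eq_0_iff_dvd)
    ultimately show ?thesis using Suc fs[of k] by simp
  qed
qed auto

lemma multiplicity_fact_less:
  assumes p: "prime (p::nat)" and "p \<ge> 5" "k > 0"
  shows "4 * multiplicity p (fact k :: nat) < k"
  using assms(3)
proof (induction k rule: less_induct)
  case (less k)
  show ?case
  proof (cases "k div p = 0")
    case True
    thus ?thesis using multiplicity_fact_div[OF p, of k] less.prems by simp
  next
    case False
    have "k div p < k" using less.prems assms by simp
    hence "4 * multiplicity p (fact (k div p) :: nat) < k div p"
      using less.IH[of "k div p"] False by simp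
    moreover have "5 * (k div p) \<le> p * (k div p)" using assms by simp
    moreover have "p * (k div p) \<le> k" by simp
    ultimately show ?thesis using multiplicity_fact_div[OF p, of k] by linarith
  qed
qed

lemma multiplicity_int: "multiplicity (int p) (int k) = multiplicity p k"
  unfolding multiplicity_def by (simp flip: of_nat_power add: int_dvd_int_iff)

text \<open>This is where \<open>p \<ge> 5\<close> is indispensable: for \<open>p = 3\<close> and \<open>k = 3\<close> both sides are equal, and the
  estimate no longer shows that the third Taylor coefficient below is smaller than the first two.\<close>

lemma padic_norm_fact_gt:
  assumes "CARD('a) \<ge> 5" and k: "k \<ge> 3"
  shows "(1 / real CARD('a)) ^ (k - 2) < padic_norm (of_nat (fact k) :: 'a::prime_card padic)"
proof -
  have "padic_norm (of_nat (fact k) :: 'a padic) = (1 / real CARD('a)) ^ multiplicity (int CARD('a)) (int (fact k))"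
    using padic_norm_of_int_nonzero[of "int (fact k)", where 'a='a] by (simp del: of_nat_fact)
  also have "multiplicity (int CARD('a)) (int (fact k)) = multiplicity CARD('a) (fact k :: nat)"
    by (simp only: multiplicity_int)
  finally have eq: "padic_norm (of_nat (fact k) :: 'a padic) = (1 / real CARD('a)) ^ multiplicity CARD('a) (fact k :: nat)" .
  have "multiplicity CARD('a) (fact k :: nat) < k - 2"
    using multiplicity_fact_less[OF prime_card[where 'a='a] assms(1), of k] k by linarith
  thus ?thesis unfolding eq using assms(1) by (intro power_strict_decreasing) auto
qed

text \<open>The falling factorial \<open>X (X - 1) \<dots> (X - k)\<close> is divisible by \<open>X\<close>; reducing the monic quotient
  modulo \<open>(X - m) (X - n)\<close> leaves an integer polynomial of degree at most one.  Thus on the two points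
  \<open>m\<close> and \<open>n\<close> all falling factorials are integer combinations, with common coefficients, of the
  first two.\<close>

lemma falling_factorial_combination:
  fixes m n :: nat
  shows "\<exists>r s :: int. \<forall>x \<in> {m, n}.
     int (fact (Suc k) * (x choose Suc k)) = r * int x + s * (int x * (int x - 1))"
proof (induction k)
  case 0
  show ?case by (rule exI[of _ 1], rule exI[of _ 0]) auto
next
  case (Suc k)
  let ?a = "int m + int n" and ?b = "int m * int n"
  from Suc obtain r s where
    rs: "\<And>x. x \<in> {m, n} \<Longrightarrow> int (fact (Suc k) * (x choose Suc k)) = r * int x + s * (int x * (int x - 1))"
    by blast
  define K where "K = int (Suc k)"
  have step: "int (fact (Suc (Suc k)) * (x choose Suc (Suc k)))
      = (int x - K) * int (fact (Suc k) * (x choose Suc k))" for x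
  proof -
    have *: "int (Suc (Suc k)) * int (x choose Suc (Suc k)) = (int x - K) * int (x choose Suc k)"
    proof (cases "Suc k \<le> x")
      case True
      have "Suc (Suc k) * (x choose Suc (Suc k)) = (x - Suc k) * (x choose Suc k)"
        using binomial_absorb_comp[of x "Suc k"] binomial_absorption[of "Suc k" x]
        by simp
      thus ?thesis using True unfolding K_def by (metis of_nat_diff of_nat_mult)
    next
      case False
      thus ?thesis by (simp add: binomial_eq_0)
    qed
    have "int (fact (Suc (Suc k)) * (x choose Suc (Suc k)))
        = int (fact (Suc k)) * (int (Suc (Suc k)) * int (x choose Suc (Suc k)))"
      unfolding fact_Suc[of "Suc k"] of_nat_mult of_nat_id by (simp only: mult_ac)
    thus ?thesis unfolding * of_nat_mult by (simp only: mult_ac)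
  qed
  define r' where "r' = r * (1 - K) + s * (?a - 1 - ?b)"
  define s' where "s' = r + s * (?a - 3) + s * (2 - K)"
  have "int (fact (Suc (Suc k)) * (x choose Suc (Suc k))) = r' * int x + s' * (int x * (int x - 1))"
    if x: "x \<in> {m, n}" for x
  proof -
    have "(int x - int m) * (int x - int n) = 0" using x by auto
    hence sq: "int x * int x = ?a * int x - ?b" by (simp add: algebra_simps)
    have "int (fact (Suc (Suc k)) * (x choose Suc (Suc k))) - (r' * int x + s' * (int x * (int x - 1)))
      = s * int x * (int x * int x - (?a * int x - ?b))"
      unfolding step rs[OF x] r'_def s'_def by (simp add: algebra_simps)
    thus ?thesis using sq by simp
  qed
  thus ?case by blast
qed

section \<open>Trinomials on a residue disc\<close>

abbreviation padic_prime :: "'a::prime_card padic" where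
  "padic_prime \<equiv> of_nat CARD('a)"

lemma coeff_monom_pcompose_linear:
  "coeff (monom A n \<circ>\<^sub>p [:x, x * P:]) k = (A * x ^ n) * P ^ k * of_nat (n choose k)"
  for A x P :: "'a::idom"
proof -
  have "monom A n \<circ>\<^sub>p [:x, x * P:] = smult (A * x ^ n) ([:1, P:] ^ n)"
  proof -
    have "[:x, x * P:] = smult x [:1, P:]" by simp
    hence "[:x, x * P:] ^ n = smult (x ^ n) ([:1, P:] ^ n)" by (simp only: smult_power)
    thus ?thesis
      by (simp add: monom_altdef pcompose_smult pcompose_hom.hom_power pcompose_pCons)
  qed
  moreover have "coeff ([:1, P:] ^ n) k = of_nat (n choose k) * P ^ k"
  proof (cases "k \<le> n")
    case True
    thus ?thesis by (simp add: coeff_linear_poly_power)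
  next
    case False
    have "degree ([:1, P:] ^ n) \<le> degree [:1, P:] * n" by (rule degree_power_le)
    also have "\<dots> \<le> n" by (cases "P = 0") auto
    finally show ?thesis using False by (simp add: coeff_eq_0 binomial_eq_0)
  qed
  ultimately show ?thesis by (simp add: mult_ac)
qed

definition trinomial :: "'a \<Rightarrow> 'a \<Rightarrow> 'a \<Rightarrow> nat \<Rightarrow> nat \<Rightarrow> 'a::comm_ring_1 poly" where
  "trinomial A B C m n = [:A:] + monom B m + monom C n"

lemma poly_trinomial: "poly (trinomial A B C m n) x = A + B * x ^ m + C * x ^ n"
  by (simp add: trinomial_def poly_monom)

lemma padic_norm_le_max_of_zero_sum:
  assumes "a + b + c = (0 :: 'a::prime_card padic)"
  shows "padic_norm a \<le> max (padic_norm b) (padic_norm c)"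
proof -
  have "a = - (b + c)" using assms unfolding eq_neg_iff_add_eq_0 add.assoc .
  thus ?thesis using padic_norm_add_le_max[of b c] by (simp only: padic_norm_uminus)
qed

lemma padic_norm_eq_of_sum_less:
  assumes "padic_norm (x + y) < padic_norm y"
  shows "padic_norm x = padic_norm y"
proof -
  have "padic_norm (x + y + - y) = padic_norm (- y)"
    using assms by (intro padic_norm_add_eq_right) simp
  thus ?thesis by simp
qed

text \<open>One of \<open>B\<close> and \<open>C\<close>, as well as \<open>A\<close>, may vanish, so that polynomials with fewer than three terms
  are covered at the same time.\<close>

locale padic_trinomial =
  fixes A B C :: "'a::prime_card padic" and m n :: nat
  assumes p5: "CARD('a) \<ge> 5" and mn: "0 < m" "m < n" and BC: "B \<noteq> 0 \<or> C \<noteq> 0"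
begin

definition f where "f = trinomial A B C m n"

lemma f_nonzero: "f \<noteq> 0"
proof
  assume "f = 0"
  hence "coeff f m = 0" "coeff f n = 0" by auto
  thus False using mn BC by (auto simp: f_def trinomial_def coeff_pCons split: nat.splits)
qed

text \<open>These are \<open>x f'(x)\<close> and \<open>x\<^sup>2 f''(x)\<close>; up to the factors \<open>p\<close> and \<open>p\<^sup>2 / 2\<close> they are the first two
  Taylor coefficients on the disc \<open>x (1 + p z)\<close>.\<close>

definition D1 where "D1 x = B * x ^ m * of_nat m + C * x ^ n * of_nat n"
definition D2 where "D2 x = B * x ^ m * of_nat (m * (m - 1)) + C * x ^ n * of_nat (n * (n - 1))"

lemma D2_eq: "D2 x = of_nat (m - 1) * D1 x + C * x ^ n * of_nat (n * (n - m))"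
proof -
  have "n - 1 = (m - 1) + (n - m)" using mn by simp
  thus ?thesis unfolding D1_def D2_def by (simp only: of_nat_mult of_nat_add) (simp add: algebra_simps)
qed

lemma D1_D2_nonzero:
  assumes "x \<noteq> 0" shows "D1 x \<noteq> 0 \<or> D2 x \<noteq> 0"
proof (rule ccontr)
  assume "\<not> ?thesis"
  hence 0: "D1 x = 0" "D2 x = 0" by auto
  hence "C * x ^ n * of_nat (n * (n - m)) = 0" using D2_eq[of x] by simp
  hence "C = 0" using assms mn by (auto simp del: of_nat_mult)
  moreover from this have "B = 0" using 0(1)[unfolded D1_def] assms mn by simp
  ultimately show False using BC by auto
qed

definition taylor_coeff where "taylor_coeff x k = coeff (f \<circ>\<^sub>p [:x, x * padic_prime:]) k"

lemma taylor_coeff_pos: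
  assumes "k > 0"
  shows "taylor_coeff x k = padic_prime ^ k * (B * x ^ m * of_nat (m choose k) + C * x ^ n * of_nat (n choose k))"
  using assms
  by (cases k) (simp_all add: taylor_coeff_def f_def trinomial_def pcompose_add coeff_monom_pcompose_linear algebra_simps)

lemma taylor_coeff_1: "taylor_coeff x 1 = padic_prime * D1 x"
  by (simp add: taylor_coeff_pos D1_def)

lemma taylor_coeff_2: "2 * taylor_coeff x 2 = padic_prime ^ 2 * D2 x"
proof -
  have two: "2 * of_nat (k choose 2) = (of_nat (k * (k - 1)) :: 'a padic)" for k
  proof -
    have "2 * (k choose 2) = k * (k - 1)" 
      using binomial_absorption[of 1 k] by (simp add: numeral_2_eq_2)
    thus ?thesis by (metis of_nat_mult of_nat_numeral)
  qed
  have "2 * taylor_coeff x 2 = padic_prime ^ 2 * (B * x ^ m * (2 * of_nat (m choose 2)) + C * x ^ n * (2 * of_nat (n choose 2)))"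
    by (simp add: taylor_coeff_pos algebra_simps)
  thus ?thesis unfolding two D2_def .
qed

lemma norm_2: "padic_norm (2 :: 'a padic) = 1"
proof -
  have "\<not> int CARD('a) dvd 2" using p5 by (auto dest: zdvd_imp_le)
  thus ?thesis using padic_norm_of_int_eq_1_iff[of 2, where 'a='a] by simp
qed

lemma norm_taylor_coeff_1: "padic_norm (taylor_coeff x 1) = padic_norm (D1 x) / real CARD('a)"
  by (simp add: taylor_coeff_1[simplified] padic_norm_mult padic_norm_prime)

lemma norm_taylor_coeff_2: "padic_norm (taylor_coeff x 2) = padic_norm (D2 x) / real CARD('a) ^ 2"
proof -
  have "padic_norm (2 * taylor_coeff x 2) = padic_norm (D2 x) / real CARD('a) ^ 2"
    unfolding taylor_coeff_2 by (simp add: padic_norm_mult padic_norm_prime padic_norm_power power_divide)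
  thus ?thesis by (simp add: padic_norm_mult norm_2)
qed

text \<open>Multiplied by \<open>k!\<close>, the coefficient of index \<open>k\<close> is \<open>p ^ k\<close> times an integer combination of \<open>D1\<close> and
  \<open>D2\<close>.  So passing from the first two coefficients to it costs at most a factor \<open>1 / k!\<close> and gains
  \<open>p ^ (k - 2)\<close>, and the gain prevails.\<close>

lemma norm_taylor_coeff_ge_3:
  assumes x: "x \<noteq> 0" and k: "k \<ge> 3"
  shows "padic_norm (taylor_coeff x k) < max (padic_norm (taylor_coeff x 1)) (padic_norm (taylor_coeff x 2))"
proof -
  define e where "e = 1 / real CARD('a)"
  have e: "0 < e" "e < 1" using p5 by (auto simp: e_def)
  define M where "M = max (padic_norm (taylor_coeff x 1)) (padic_norm (taylor_coeff x 2))"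
  have n1: "padic_norm (taylor_coeff x 1) = e * padic_norm (D1 x)"
    by (simp add: norm_taylor_coeff_1[simplified] e_def)
  have n2: "padic_norm (taylor_coeff x 2) = e ^ 2 * padic_norm (D2 x)" by (simp add: norm_taylor_coeff_2 e_def power_divide)
  have M0: "M > 0"
    using D1_D2_nonzero[OF x] e unfolding M_def n1 n2 by (auto simp: less_max_iff_disj)
  have d1: "e ^ 2 * padic_norm (D1 x) \<le> M"
  proof -
    have "e ^ 2 * padic_norm (D1 x) \<le> e * padic_norm (D1 x)"
      using e by (intro mult_right_mono) (auto simp: power2_eq_square)
    thus ?thesis unfolding M_def n1 by simp
  qed
  have d2: "e ^ 2 * padic_norm (D2 x) \<le> M" unfolding M_def n2 by simp
  obtain r s :: int where rs: "\<And>y. y \<in> {m, n} \<Longrightarrow>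
      int (fact k * (y choose k)) = r * int y + s * (int y * (int y - 1))"
    using falling_factorial_combination[of m n "k - 1"] k by auto
  have rs': "of_nat (fact k) * of_nat (y choose k)
      = of_int r * of_nat y + of_int s * (of_nat (y * (y - 1)) :: 'a padic)" if "y \<in> {m, n}" for y
  proof -
    have "int (fact k * (y choose k)) = r * int y + s * int (y * (y - 1))"
      using rs[OF that] that mn by (auto simp: of_nat_diff)
    hence "of_int (int (fact k * (y choose k))) = (of_int (r * int y + s * int (y * (y - 1))) :: 'a padic)"
      by (rule arg_cong)
    thus ?thesis by (simp only: of_int_of_nat_eq of_int_add of_int_mult of_nat_mult)
  qed
  have "of_nat (fact k) * taylor_coeff x k = padic_prime ^ k * (B * x ^ m * (of_nat (fact k) * of_nat (m choose k))
      + C * x ^ n * (of_nat (fact k) * of_nat (n choose k)))"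
    using k by (simp add: taylor_coeff_pos algebra_simps)
  also have "\<dots> = padic_prime ^ k * (of_int r * D1 x + of_int s * D2 x)"
    unfolding D1_def D2_def by (subst (1 2) rs') (simp_all add: algebra_simps)
  finally have eq: "of_nat (fact k) * taylor_coeff x k = padic_prime ^ k * (of_int r * D1 x + of_int s * D2 x)" .
  have "padic_norm (of_int r * D1 x + of_int s * D2 x)
      \<le> max (padic_norm (of_int r * D1 x)) (padic_norm (of_int s * D2 x))"
    by (rule padic_norm_add_le_max)
  also have "\<dots> \<le> max (padic_norm (D1 x)) (padic_norm (D2 x))"
    unfolding padic_norm_mult by (intro max.mono mult_left_le_one_le) auto
  finally have "e ^ 2 * padic_norm (of_int r * D1 x + of_int s * D2 x)
      \<le> e ^ 2 * max (padic_norm (D1 x)) (padic_norm (D2 x))"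
    using e by (intro mult_left_mono) auto
  also have "\<dots> \<le> M" using d1 d2 by (simp add: max_def)
  finally have bound: "e ^ 2 * padic_norm (of_int r * D1 x + of_int s * D2 x) \<le> M" .
  have "padic_norm (of_nat (fact k) :: 'a padic) * padic_norm (taylor_coeff x k)
      = e ^ k * padic_norm (of_int r * D1 x + of_int s * D2 x)"
    using arg_cong[OF eq, of padic_norm] by (simp only: padic_norm_mult padic_norm_power padic_norm_prime e_def)
  also have "e ^ k = e ^ (k - 2) * e ^ 2" 
  proof -
    have "k = (k - 2) + 2" using k by simp
    thus ?thesis by (metis power_add)
  qed
  also have "e ^ (k - 2) * e ^ 2 * padic_norm (of_int r * D1 x + of_int s * D2 x) \<le> e ^ (k - 2) * M"
    unfolding mult.assoc using bound e by (intro mult_left_mono) auto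
  also have "\<dots> < padic_norm (of_nat (fact k) :: 'a padic) * M"
    using padic_norm_fact_gt[OF p5 k] M0 unfolding e_def by (intro mult_strict_right_mono) auto
  finally show ?thesis
    unfolding M_def[symmetric] by (rule mult_left_less_imp_less) simp
qed

context
  fixes S :: "'a padic set" and x :: "'a padic"
  assumes S: "finite S" "\<And>y. y \<in> S \<Longrightarrow> padic_norm (y - x) \<le> padic_norm (x * padic_prime)" and x: "x \<noteq> 0"
begin

lemma dominant_index_disc:
  obtains j where "(\<Sum>y\<in>S. order y f) \<le> j" "j \<le> 2" "\<And>i. padic_norm (taylor_coeff x i) \<le> padic_norm (taylor_coeff x j)"
proof -
  have "x * padic_prime \<noteq> 0" using x by simp
  then obtain j where j: "(\<Sum>y\<in>S. order y f) \<le> j" "dominant_index j (f \<circ>\<^sub>p [:x, x * padic_prime:])"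
    using dominant_index_ge_sum_order[OF f_nonzero S(1) _ S(2)] by blast
  have le: "padic_norm (taylor_coeff x i) \<le> padic_norm (taylor_coeff x j)" for i
    using j(2) by (auto simp: dominant_index_def taylor_coeff_def)
  have "j \<le> 2"
  proof (rule ccontr)
    assume "\<not> j \<le> 2"
    thus False using norm_taylor_coeff_ge_3[OF x, of j] le[of 1] le[of 2] by auto
  qed
  thus ?thesis using le by (rule that[OF j(1)])
qed

lemma sum_order_disc_le_2: "(\<Sum>y\<in>S. order y f) \<le> 2"
  using dominant_index_disc by (metis order.trans)

text \<open>Two zeros force the dominant index to be \<open>2\<close>, so \<open>D1\<close> is small compared with \<open>D2\<close>.  Since
  \<open>D2 = (m - 1) D1 + C x ^ n \<cdot> n (n - m)\<close>, the last summand then has the norm of \<open>D2\<close>.\<close>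

lemma sum_order_disc_ge_2:
  assumes "(\<Sum>y\<in>S. order y f) \<ge> 2"
  shows "padic_norm (D1 x) < padic_norm (C * x ^ n * of_nat (n * (n - m)))"
proof -
  obtain j where "(\<Sum>y\<in>S. order y f) \<le> j" "j \<le> 2" "\<And>i. padic_norm (taylor_coeff x i) \<le> padic_norm (taylor_coeff x j)"
    using dominant_index_disc by metis
  hence le: "padic_norm (taylor_coeff x 1) \<le> padic_norm (taylor_coeff x 2)" using assms by (metis order.trans order.antisym)
  have p0: "real CARD('a) > 1" using p5 by simp
  have le': "padic_norm (D1 x) * real CARD('a) \<le> padic_norm (D2 x)"
    using le p0 unfolding norm_taylor_coeff_1 norm_taylor_coeff_2 by (simp add: field_simps power2_eq_square)
  have lt: "padic_norm (D1 x) < padic_norm (D2 x)"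
  proof (cases "D1 x = 0")
    case False
    hence "padic_norm (D1 x) * 1 < padic_norm (D1 x) * real CARD('a)"
      using p0 by (intro mult_strict_left_mono) auto
    thus ?thesis using le' by simp
  qed (use D1_D2_nonzero[OF x] in auto)
  have "padic_norm (of_nat (m - 1) * D1 x) \<le> padic_norm (D1 x)"
    unfolding padic_norm_mult by (intro mult_left_le_one_le) auto
  hence "padic_norm (- (of_nat (m - 1) * D1 x) + D2 x) = padic_norm (D2 x)"
    using lt by (intro padic_norm_add_eq_right) simp
  hence "padic_norm (C * x ^ n * of_nat (n * (n - m))) = padic_norm (D2 x)"
    using D2_eq[of x] by simp
  thus ?thesis using lt by simp
qed

text \<open>The near vanishing of \<open>D1 = m B x ^ m + n C x ^ n\<close> makes its two summands equal in norm; the term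
  of larger norm has the \<open>p\<close>-adically smaller exponent.\<close>

lemma two_zeros_inner_disc:
  assumes "(\<Sum>y\<in>S. order y f) \<ge> 2" and CB: "padic_norm (C * x ^ n) < padic_norm (B * x ^ m)"
  shows "padic_norm (of_nat m :: 'a padic) < padic_norm (of_nat n :: 'a padic)"
proof -
  let ?b = "B * x ^ m" and ?c = "C * x ^ n"
  have "padic_norm (?c * of_nat n) * padic_norm (of_nat (n - m) :: 'a padic) \<le> padic_norm (?c * of_nat n)"
    by (intro mult_right_le_one_le) auto
  hence "padic_norm (D1 x) < padic_norm (?c * of_nat n)"
    using sum_order_disc_ge_2[OF assms(1)] by (simp add: padic_norm_mult mult_ac)
  hence eq: "padic_norm (?b * of_nat m) = padic_norm (?c * of_nat n)"
    unfolding D1_def by (rule padic_norm_eq_of_sum_less)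
  have b0: "padic_norm ?b > 0" using CB padic_norm_ge_0 le_less_trans by blast
  have n0: "padic_norm (of_nat n :: 'a padic) > 0" using mn by simp
  have "padic_norm ?b * padic_norm (of_nat m :: 'a padic) = padic_norm ?c * padic_norm (of_nat n :: 'a padic)"
    using eq by (simp only: padic_norm_mult)
  also have "\<dots> < padic_norm ?b * padic_norm (of_nat n :: 'a padic)"
    using CB n0 by (rule mult_strict_right_mono)
  finally show ?thesis using b0 by (simp only: mult_less_cancel_left_pos)
qed

text \<open>The mirror image of the preceding lemma under \<open>x \<mapsto> 1/x\<close>, which replaces \<open>m\<close> by \<open>n - m\<close>.
  Instead of reversing the polynomial, the equation \<open>f x = 0\<close> is used to rewrite \<open>- D1\<close> as
  \<open>n A + (n - m) B x ^ m\<close>.\<close>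

lemma two_zeros_outer_disc:
  assumes "(\<Sum>y\<in>S. order y f) \<ge> 2" and root: "poly f x = 0"
    and AB: "padic_norm A < padic_norm (B * x ^ m)" and CB: "padic_norm (C * x ^ n) \<le> padic_norm (B * x ^ m)"
  shows "padic_norm (of_nat (n - m) :: 'a padic) < padic_norm (of_nat n :: 'a padic)"
proof -
  let ?b = "B * x ^ m" and ?c = "C * x ^ n"
  have "A + ?b + ?c = 0" using root by (simp add: f_def poly_trinomial)
  hence c: "?c = - A - ?b" by (simp add: eq_neg_iff_add_eq_0 algebra_simps)
  have "- D1 x = of_nat n * A + of_nat (n - m) * ?b"
    unfolding D1_def c using mn by (simp add: of_nat_diff algebra_simps)
  hence ND: "padic_norm (D1 x) = padic_norm (of_nat n * A + of_nat (n - m) * ?b)"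
    by (metis padic_norm_uminus)
  have "padic_norm (?c * of_nat (n * (n - m))) = padic_norm (of_nat n :: 'a padic) * (padic_norm (of_nat (n - m) :: 'a padic) * padic_norm ?c)"
    by (simp add: padic_norm_mult mult_ac)
  also have "\<dots> \<le> padic_norm (of_nat (n - m) :: 'a padic) * padic_norm ?c"
    by (intro mult_left_le_one_le mult_nonneg_nonneg) auto
  also have "\<dots> \<le> padic_norm (of_nat (n - m) :: 'a padic) * padic_norm ?b"
    using CB by (intro mult_left_mono) auto
  finally have "padic_norm (of_nat n * A + of_nat (n - m) * ?b) < padic_norm (of_nat (n - m) * ?b)"
    using sum_order_disc_ge_2[OF assms(1)] ND by (simp only: padic_norm_mult)
  hence eq: "padic_norm (of_nat n * A) = padic_norm (of_nat (n - m) * ?b)"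
    by (rule padic_norm_eq_of_sum_less)
  have b0: "padic_norm ?b > 0" using AB padic_norm_ge_0 le_less_trans by blast
  have n0: "padic_norm (of_nat n :: 'a padic) > 0" using mn by simp
  have "padic_norm ?b * padic_norm (of_nat (n - m) :: 'a padic) = padic_norm A * padic_norm (of_nat n :: 'a padic)"
    using eq by (simp only: padic_norm_mult mult.commute)
  also have "\<dots> < padic_norm ?b * padic_norm (of_nat n :: 'a padic)"
    using AB n0 by (rule mult_strict_right_mono)
  finally show ?thesis using b0 by (simp only: mult_less_cancel_left_pos)
qed

end

text \<open>At a zero the largest norm among the three terms is attained twice.  As \<open>\<bar>x\<bar>\<close> grows, a term of
  higher degree gains on one of lower degree, so between the two norms the dominant pair has to move
  from \<open>{A, B}\<close> to \<open>{B, C}\<close>: these are the two edges of the Newton polygon.\<close>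

lemma dominant_terms_of_two_norms:
  assumes xy: "x \<noteq> 0" "poly f x = 0" "poly f y = 0" "padic_norm x < padic_norm y"
  shows "padic_norm (C * x ^ n) < padic_norm (B * x ^ m)"
    and "padic_norm A < padic_norm (B * y ^ m)"
    and "padic_norm (C * y ^ n) \<le> padic_norm (B * y ^ m)"
proof -
  let ?a = "padic_norm A" and ?b = "padic_norm B" and ?c = "padic_norm C"
  let ?u = "padic_norm x" and ?v = "padic_norm y"
  have uv: "0 < ?u" "?u < ?v" using xy by auto
  have zx: "A + B * x ^ m + C * x ^ n = 0" and zy: "A + B * y ^ m + C * y ^ n = 0"
    using xy by (auto simp: f_def poly_trinomial)
  have zx': "C * x ^ n + A + B * x ^ m = 0" "B * x ^ m + C * x ^ n + A = 0" using zx by (simp_all add: add_ac)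
  have zy': "C * y ^ n + A + B * y ^ m = 0" using zy by (simp_all add: add_ac)
  note nm = padic_norm_mult padic_norm_power
  have ax: "?a \<le> max (?b * ?u ^ m) (?c * ?u ^ n)" using padic_norm_le_max_of_zero_sum[OF zx] by (simp only: nm)
  have cy: "?c * ?v ^ n \<le> max ?a (?b * ?v ^ m)" using padic_norm_le_max_of_zero_sum[OF zy'(1)] by (simp only: nm)
  have less: "?c * ?u ^ n < ?b * ?u ^ m"
  proof (rule ccontr)
    assume "\<not> ?thesis"
    hence ge: "?b * ?u ^ m \<le> ?c * ?u ^ n" by simp
    have c0: "?c > 0"
    proof (rule ccontr)
      assume "\<not> ?c > 0"
      hence "C = 0" by simp
      hence "?b * ?u ^ m \<le> 0" using ge by simp
      hence "B = 0" 
        by (metis mult_pos_pos not_less padic_norm_pos_iff uv(1) zero_less_power)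
      thus False using BC \<open>C = 0\<close> by simp
    qed
    have "?b * ?u ^ m * ?v ^ m \<le> ?c * ?u ^ n * ?v ^ m" using ge uv by (intro mult_right_mono) auto
    also have "\<dots> = ?c * ?u ^ m * ?v ^ m * ?u ^ (n - m)" using mn by (simp add: mult_ac flip: power_add)
    also have "\<dots> < ?c * ?u ^ m * ?v ^ m * ?v ^ (n - m)"

    proof (intro mult_strict_left_mono power_strict_mono)
      show "0 < ?c * ?u ^ m * ?v ^ m"
        using c0 uv by (intro mult_pos_pos zero_less_power) linarith+
    qed (use uv mn in auto)
    also have "\<dots> = ?u ^ m * (?c * ?v ^ n)" using mn by (simp add: mult_ac flip: power_add)
    finally have "?u ^ m * (?b * ?v ^ m) < ?u ^ m * (?c * ?v ^ n)" by (simp add: mult_ac)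
    hence bv: "?b * ?v ^ m < ?c * ?v ^ n" using uv by simp
    have "?c * ?u ^ n < ?c * ?v ^ n" using c0 uv mn by (intro mult_strict_left_mono power_strict_mono) auto
    hence "?a < ?c * ?v ^ n" using ax ge by simp
    thus False using bv cy by simp
  qed
  thus "padic_norm (C * x ^ n) < padic_norm (B * x ^ m)" by (simp only: nm)
  have "?b > 0"
  proof (rule ccontr)
    assume "\<not> ?b > 0"
    hence "?b * ?u ^ m = 0" by simp
    moreover have "?c * ?u ^ n \<ge> 0" by simp
    ultimately show False using less by linarith
  qed
  hence "?b * ?u ^ m < ?b * ?v ^ m" using uv mn by (intro mult_strict_left_mono power_strict_mono) auto
  hence *: "?a < ?b * ?v ^ m" using ax less by simp
  thus "padic_norm A < padic_norm (B * y ^ m)" by (simp only: nm)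
  show "padic_norm (C * y ^ n) \<le> padic_norm (B * y ^ m)" using cy * by (simp add: nm)
qed

lemma no_three_norms:
  assumes "x \<noteq> 0" "poly f x = 0" "poly f y = 0" "poly f z = 0"
    "padic_norm x < padic_norm y" "padic_norm y < padic_norm z"
  shows False
proof -
  have y: "y \<noteq> 0" using assms(5) by (metis padic_norm_0 padic_norm_ge_0 not_less)
  have "B * y ^ m + C * y ^ n + A = 0" using assms by (simp add: f_def poly_trinomial add_ac)
  from padic_norm_le_max_of_zero_sum[OF this] show False
    using dominant_terms_of_two_norms(1)[OF y assms(3,4,6)] dominant_terms_of_two_norms(2)[OF assms(1,2,3,5)] by simp
qed

end

section \<open>Counting all nonzero zeros\<close>

text \<open>Dividing by a reference point \<open>x1\<close> of the sphere makes every other point a unit, whose residue is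
  one of \<open>p - 1\<close> nonzero classes.\<close>

lemma sphere_residues:
  fixes x1 :: "'a::prime_card padic"
  assumes x1: "x1 \<noteq> 0"
  obtains \<rho> :: "'a padic \<Rightarrow> nat" where "\<And>x. padic_norm x = padic_norm x1 \<Longrightarrow> \<rho> x \<in> {1..CARD('a) - 1}"
    "\<And>x y. padic_norm x = padic_norm x1 \<Longrightarrow> padic_norm y = padic_norm x1 \<Longrightarrow> \<rho> x = \<rho> y \<Longrightarrow>
       padic_norm (y - x) \<le> padic_norm (x * padic_prime)"
proof -
  have N0: "padic_norm x1 > 0" using x1 by simp
  define \<rho> where "\<rho> = (\<lambda>x. SOME r. r < CARD('a) \<and> padic_norm (x / x1 - of_nat r) < 1)"
  have \<rho>: "\<rho> x < CARD('a) \<and> padic_norm (x / x1 - of_nat (\<rho> x)) < 1" 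
    if "padic_norm x = padic_norm x1" for x :: "'a padic"
  proof -
    have "padic_norm (x / x1) \<le> 1" using that N0 by (simp add: padic_norm_divide)
    thus ?thesis unfolding \<rho>_def using padic_residue[of "x / x1"] by (metis (mono_tags, lifting) someI_ex)
  qed
  show ?thesis
  proof (rule that)
    fix x :: "'a padic" assume x: "padic_norm x = padic_norm x1"
    have "\<rho> x \<noteq> 0"
    proof
      assume "\<rho> x = 0"
      hence "padic_norm (x / x1) < 1" using \<rho>[OF x] by simp
      thus False using x N0 by (simp add: padic_norm_divide)
    qed
    thus "\<rho> x \<in> {1..CARD('a) - 1}" using \<rho>[OF x] by auto
  next
    fix x y :: "'a padic" assume x: "padic_norm x = padic_norm x1" and y: "padic_norm y = padic_norm x1" and xy: "\<rho> x = \<rho> y"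
    have "padic_norm ((y / x1 - of_nat (\<rho> y)) - (x / x1 - of_nat (\<rho> x)))
       \<le> max (padic_norm (y / x1 - of_nat (\<rho> y))) (padic_norm (x / x1 - of_nat (\<rho> x)))"
      by (rule padic_norm_diff_le_max)
    hence "padic_norm ((y - x) / x1)
       \<le> max (padic_norm (y / x1 - of_nat (\<rho> y))) (padic_norm (x / x1 - of_nat (\<rho> x)))"
      by (simp add: xy diff_divide_distrib)
    hence "padic_norm ((y - x) / x1) < 1"
      using \<rho>[OF x] \<rho>[OF y] by (meson le_less_trans max_less_iff_conj)
    hence "padic_norm ((y - x) / x1) \<le> 1 / real CARD('a)" by (rule padic_norm_less_1_imp)
    thus "padic_norm (y - x) \<le> padic_norm (x * padic_prime)"
      using N0 x by (simp add: padic_norm_divide padic_norm_mult padic_norm_prime field_simps)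
  qed
qed

lemma sum_sphere_le:
  fixes w :: "'a::prime_card padic \<Rightarrow> nat" and x1 :: "'a padic"
  assumes S: "finite S" "\<And>x. x \<in> S \<Longrightarrow> padic_norm x = padic_norm x1" and x1: "x1 \<noteq> 0"
    and B: "\<And>x. x \<in> S \<Longrightarrow> (\<Sum>y\<in>{y\<in>S. padic_norm (y - x) \<le> padic_norm (x * padic_prime)}. w y) \<le> B"
  shows "sum w S \<le> (CARD('a) - 1) * B"
proof -
  obtain \<rho> :: "'a padic \<Rightarrow> nat" where \<rho>: "\<And>x. padic_norm x = padic_norm x1 \<Longrightarrow> \<rho> x \<in> {1..CARD('a) - 1}"
    "\<And>x y. padic_norm x = padic_norm x1 \<Longrightarrow> padic_norm y = padic_norm x1 \<Longrightarrow> \<rho> x = \<rho> y \<Longrightarrow>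
       padic_norm (y - x) \<le> padic_norm (x * padic_prime)"
    using sphere_residues[OF x1] by metis
  have "sum w S = (\<Sum>r\<in>{1..CARD('a) - 1}. sum w {x \<in> S. \<rho> x = r})"
    using S \<rho>(1) by (intro sum.group[symmetric]) auto
  also have "\<dots> \<le> (\<Sum>r\<in>{1..CARD('a) - 1}. B)"
  proof (rule sum_mono)
    fix r
    show "sum w {x \<in> S. \<rho> x = r} \<le> B"
    proof (cases "{x \<in> S. \<rho> x = r} = {}")
      case False
      then obtain x where x: "x \<in> S" "\<rho> x = r" by blast
      have "sum w {x \<in> S. \<rho> x = r} \<le> (\<Sum>y\<in>{y\<in>S. padic_norm (y - x) \<le> padic_norm (x * padic_prime)}. w y)"
        using S x \<rho>(2) by (intro sum_mono2) auto
      thus ?thesis using B[OF x(1)] by simp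
    qed (simp only: sum.empty)
  qed
  finally show ?thesis by simp
qed

context padic_trinomial
begin

text \<open>Each sphere carries at most \<open>2 (p - 1)\<close> zeros.  With two spheres present, a disc with two zeros on
  each would give \<open>\<bar>m\<bar> < \<bar>n\<bar>\<close> and \<open>\<bar>n - m\<bar> < \<bar>n\<bar>\<close>, against the ultrametric inequality; so one
  of the spheres carries at most \<open>p - 1\<close>.\<close>

lemma sum_order_trinomial_le: "(\<Sum>x | x \<noteq> 0 \<and> poly f x = 0. order x f) \<le> 3 * (CARD('a) - 1)"
proof -
  define R where "R = {x. x \<noteq> 0 \<and> poly f x = 0}"
  have finR: "finite R" unfolding R_def using poly_roots_finite[OF f_nonzero] by simp
  define sph where "sph x = {y \<in> R. padic_norm y = padic_norm x}" for x :: "'a padic"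
  define cl where "cl z x = {y \<in> sph z. padic_norm (y - x) \<le> padic_norm (x * padic_prime)}" for z x :: "'a padic"
  have R: "x \<noteq> 0" "poly f x = 0" if "x \<in> R" for x using that by (auto simp: R_def)
  have fin: "finite (sph z)" "finite (cl z x)" for z x using finR by (auto simp: sph_def cl_def)
  have le2: "(\<Sum>y\<in>cl z x. order y f) \<le> 2" if "x \<in> R" for x z
    using that R by (intro sum_order_disc_le_2[of _ x] fin) (auto simp: cl_def)
  have sphB: "(\<Sum>y\<in>sph z. order y f) \<le> (CARD('a) - 1) * k"
    if "z \<in> R" "\<And>x. x \<in> sph z \<Longrightarrow> (\<Sum>y\<in>cl z x. order y f) \<le> k" for z k
    using that fin R[OF that(1)] unfolding cl_def by (intro sum_sphere_le[of _ z]) (auto simp: sph_def)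
  have sph2: "(\<Sum>y\<in>sph z. order y f) \<le> (CARD('a) - 1) * 2" if "z \<in> R" for z
    using that le2 by (intro sphB) (auto simp: sph_def)
  show ?thesis
  proof (cases "\<exists>x\<in>R. \<exists>y\<in>R. padic_norm x < padic_norm y")
    case False
    hence eq: "padic_norm x = padic_norm y" if "x \<in> R" "y \<in> R" for x y using that by (meson linorder_cases)
    show ?thesis
    proof (cases "R = {}")
      case False
      then obtain z where z: "z \<in> R" by blast
      have "R = sph z" unfolding sph_def using eq[OF _ z] by blast
      thus ?thesis using sph2[OF z] unfolding R_def[symmetric] by simp
    qed (simp add: R_def[symmetric])
  next
    case True
    then obtain x y where xy: "x \<in> R" "y \<in> R" "padic_norm x < padic_norm y" by blast
    have "z \<in> sph x \<union> sph y" if z: "z \<in> R" for z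
    proof (rule ccontr)
      assume "z \<notin> sph x \<union> sph y"
      hence "padic_norm z \<noteq> padic_norm x" "padic_norm z \<noteq> padic_norm y" using z by (auto simp: sph_def)
      then consider "padic_norm z < padic_norm x" | "padic_norm x < padic_norm z" "padic_norm z < padic_norm y"
        | "padic_norm y < padic_norm z" by linarith
      thus False
        using no_three_norms[of z x y] no_three_norms[of x z y] no_three_norms[of x y z] R xy z
        by cases auto
    qed
    hence RU: "R = sph x \<union> sph y" by (auto simp: sph_def)
    have tot: "(\<Sum>z\<in>R. order z f) \<le> (\<Sum>z\<in>sph x. order z f) + (\<Sum>z\<in>sph y. order z f)"
      unfolding RU using fin by (simp add: sum_Un_nat)
    have "(\<Sum>z\<in>sph x. order z f) \<le> (CARD('a) - 1) * 1 \<or> (\<Sum>z\<in>sph y. order z f) \<le> (CARD('a) - 1) * 1"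
    proof (rule ccontr)
      assume neg: "\<not> ?thesis"
      obtain a where a: "a \<in> sph x" "(\<Sum>z\<in>cl x a. order z f) > 1"
        using sphB[OF xy(1), of 1] neg by (meson not_le)
      obtain b where b: "b \<in> sph y" "(\<Sum>z\<in>cl y b. order z f) > 1"
        using sphB[OF xy(2), of 1] neg by (meson not_le)
      have ab: "a \<in> R" "b \<in> R" "padic_norm a < padic_norm b" using a b xy by (auto simp: sph_def)
      note tn = dominant_terms_of_two_norms[OF R(1)[OF ab(1)] R(2)[OF ab(1)] R(2)[OF ab(2)] ab(3)]
      have m: "padic_norm (of_nat m :: 'a padic) < padic_norm (of_nat n :: 'a padic)"
        using a(2) fin R[OF ab(1)] tn(1) by (intro two_zeros_inner_disc[of "cl x a" a]) (auto simp: cl_def)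
      have nm: "padic_norm (of_nat (n - m) :: 'a padic) < padic_norm (of_nat n :: 'a padic)"
        using b(2) fin R[OF ab(2)] tn(2,3) by (intro two_zeros_outer_disc[of "cl y b" b]) (auto simp: cl_def)
      have "padic_norm (of_nat n :: 'a padic) \<le> max (padic_norm (of_nat m :: 'a padic)) (padic_norm (of_nat (n - m) :: 'a padic))"
        using padic_norm_add_le_max[of "of_nat m :: 'a padic" "of_nat (n - m)"] mn by (simp flip: of_nat_add)
      thus False using m nm by simp
    qed
    thus ?thesis using tot sph2[OF xy(1)] sph2[OF xy(2)] unfolding R_def[symmetric] by linarith
  qed
qed

end

lemma fewnomial_sum_order_le:
  fixes F :: "'a::prime_card padic poly"
  assumes p5: "CARD('a) \<ge> 5" and F: "F \<in> fewnomials 2"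
  shows "(\<Sum>x | x \<noteq> 0 \<and> poly F x = 0. order x F) \<le> 3 * (CARD('a) - 1)"
proof -
  define S where "S = {i. coeff F i \<noteq> 0}"
  have F0: "F \<noteq> 0" and cS: "card S \<le> 3" using F by (auto simp: fewnomials_def S_def)
  have finS: "finite S" unfolding S_def by (rule finite_subset[of _ "{..degree F}"]) (auto intro: le_degree)
  \<comment> \<open>Padding the support to three exponents; the additional coefficients are zero.\<close>
  obtain T where T: "S \<subseteq> T" "card T = 3" "finite T"
  proof -
    obtain U :: "nat set" where U: "finite U" "card U = 3 - card S" "S \<inter> U = {}"
      using infinite_arbitrarily_large[of "- S" "3 - card S"] finS
      by (metis Compl_eq_Diff_UNIV Diff_infinite_finite disjoint_eq_subset_Compl inf_commute infinite_UNIV_nat)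
    thus ?thesis using finS cS that[of "S \<union> U"] by (simp add: card_Un_disjoint)
  qed
  define l where "l = sorted_list_of_set T"
  have l: "sorted_wrt (<) l" "length l = 3" "set l = T" using T by (auto simp: l_def)
  then obtain a b c where abc: "l = [a, b, c]" by (auto simp: length_Suc_conv numeral_3_eq_3)
  have ab: "a < b" "b < c" and Tabc: "T = {a, b, c}" using l abc by auto
  define m n where "m = b - a" and "n = c - a"
  define A B C where "A = coeff F a" and "B = coeff F b" and "C = coeff F c"
  have mn: "0 < m" "m < n" using ab by (auto simp: m_def n_def)
  have sup: "coeff F i = 0" if "i \<noteq> a" "i \<noteq> b" "i \<noteq> c" for i using T Tabc that by (auto simp: S_def)
  have Feq: "F = monom 1 a * trinomial A B C m n"
  proof (rule poly_eqI)
    fix i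
    have "monom 1 a * trinomial A B C m n = monom A a + monom B b + monom C c"
      using ab by (simp add: trinomial_def distrib_left mult_monom m_def n_def flip: monom_0)
    thus "coeff F i = coeff (monom 1 a * trinomial A B C m n) i"
      using sup[of i] ab by (auto simp: A_def B_def C_def)
  qed
  define g where "g = trinomial A B C m n"
  have g0: "g \<noteq> 0" using F0 Feq by (auto simp: g_def)
  have roots: "{x. x \<noteq> 0 \<and> poly F x = 0} = {x. x \<noteq> 0 \<and> poly g x = 0}"
    unfolding Feq g_def by (auto simp: poly_monom)
  have ord: "order x F = order x g" if "x \<noteq> 0" for x
  proof -
    have "order x F = order x (monom 1 a :: 'a padic poly) + order x g"
      using F0 unfolding Feq g_def by (rule order_mult)
    thus ?thesis using that by (simp add: order_0I poly_monom)
  qed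
  have "(\<Sum>x | x \<noteq> 0 \<and> poly F x = 0. order x F) = (\<Sum>x | x \<noteq> 0 \<and> poly g x = 0. order x g)"
    unfolding roots using ord by (intro sum.cong) auto
  also have "\<dots> \<le> 3 * (CARD('a) - 1)"
  proof (cases "B \<noteq> 0 \<or> C \<noteq> 0")
    case True
    interpret padic_trinomial A B C m n by unfold_locales (use p5 mn True in auto)
    show ?thesis using sum_order_trinomial_le unfolding f_def g_def .
  next
    case False
    hence "g = [:A:]" by (simp add: g_def trinomial_def)
    thus ?thesis using g0 by simp
  qed
  finally show ?thesis .
qed

section \<open>Lifting simple zeros modulo \<open>p\<close>\<close>

lemma poly_taylor_int: "\<exists>q::int. poly g (a + h) = poly g a + h * poly (pderiv g) a + h ^ 2 * q"
proof (induction g)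
  case (pCons c g)
  then obtain q where q: "poly g (a + h) = poly g a + h * poly (pderiv g) a + h ^ 2 * q" by blast
  have "poly (pCons c g) (a + h)
      = poly (pCons c g) a + h * poly (pderiv (pCons c g)) a + h ^ 2 * (poly (pderiv g) a + (a + h) * q)"
    by (simp add: q pderiv_pCons algebra_simps power2_eq_square)
  thus ?case by blast
qed auto

lemma dvd_poly_diff: "(a - b :: int) dvd poly g a - poly g b"
proof -
  obtain q where "poly g (b + (a - b)) = poly g b + (a - b) * poly (pderiv g) b + (a - b) ^ 2 * q"
    using poly_taylor_int by blast
  hence "poly g a - poly g b = (a - b) * (poly (pderiv g) b + (a - b) * q)"
    by (simp add: power2_eq_square algebra_simps)
  thus ?thesis by simp
qed

text \<open>Evaluation commutes with passing to the class of a sequence.  Hence a Cauchy sequence of integers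
  along which \<open>g\<close> tends to zero represents a zero of \<open>g\<close>.\<close>

lemma poly_padic_of_seq:
  assumes X: "padic_cauchy CARD('a) (\<lambda>n. of_int (X n))"
  shows "padic_cauchy CARD('a) (\<lambda>n. of_int (poly g (X n))) \<and>
    poly (map_poly of_int g) (padic_of_seq (\<lambda>n. of_int (X n)) :: 'a::prime_card padic)
      = padic_of_seq (\<lambda>n. of_int (poly g (X n)))"
proof (induction g)
  case (pCons c g)
  let ?Y = "\<lambda>n. of_int (poly g (X n))" and ?X = "\<lambda>n. of_int (X n) :: rat"
  have Y: "padic_cauchy CARD('a) ?Y" using pCons by simp
  have XY: "padic_cauchy CARD('a) (\<lambda>n. ?X n * ?Y n)"
    by (intro padic_cauchy_mult prime_card X Y)
  have C: "padic_cauchy CARD('a) (\<lambda>n. of_int c)" by simp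
  have "poly (map_poly of_int (pCons c g)) (padic_of_seq ?X :: 'a padic)
      = of_int c + padic_of_seq ?X * padic_of_seq ?Y"
    using pCons by (simp add: map_poly_pCons)
  also have "\<dots> = padic_of_seq (\<lambda>n. of_int c + ?X n * ?Y n)"
    unfolding padic_of_seq_of_int[symmetric] padic_of_seq_mult[OF X Y] padic_of_seq_add[OF C XY] ..
  finally show ?case
    using padic_cauchy_add[OF prime_card C XY] by simp
qed (simp add: padic_of_seq_0)

lemma padic_abs_of_int_le_iff:
  "padic_abs CARD('a::prime_card) (of_int k) \<le> (1 / real CARD('a)) ^ n \<longleftrightarrow> int CARD('a) ^ n dvd k"
  using padic_norm_of_int_le_iff[of k n, where 'a='a] by (simp add: padic_norm_of_int)

lemma hensel:
  fixes g :: "int poly"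
  assumes root: "int CARD('a) dvd poly g a" and simple: "\<not> int CARD('a) dvd poly (pderiv g) a"
  obtains x :: "'a::prime_card padic" where "poly (map_poly of_int g) x = 0" "padic_norm (x - of_int a) < 1"
proof -
  let ?p = "int CARD('a)"
  have p: "prime ?p" by (rule prime_card_int)
  have p1: "real CARD('a) > 1" by (rule prime_card_gt_1)
  have "\<exists>b. \<forall>n. (?p ^ Suc n dvd poly g (b n) \<and> ?p dvd b n - a) \<and> ?p ^ Suc n dvd b (Suc n) - b n"
  proof (rule dependent_nat_choice)
    show "\<exists>x. ?p ^ Suc 0 dvd poly g x \<and> ?p dvd x - a" using root by (intro exI[of _ a]) auto
  next
    fix b n assume b: "?p ^ Suc n dvd poly g b \<and> ?p dvd b - a"
    define P where "P = ?p ^ Suc n"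
    obtain u where u: "poly g b = P * u" using b by (auto simp: P_def elim: dvdE)
    have "?p dvd poly (pderiv g) b - poly (pderiv g) a"
      using b dvd_poly_diff dvd_trans by blast
    hence "\<not> ?p dvd poly (pderiv g) b" using simple by (metis dvd_diff_right_iff dvd_diff_commute)
    hence "coprime (poly (pderiv g) b) ?p" using p by (metis coprime_commute prime_imp_coprime)
    then obtain w where w: "[poly (pderiv g) b * w = 1] (mod ?p)" using cong_solve_coprime_int by blast
    \<comment> \<open>The Newton step: \<open>t = - u / g'(b)\<close> modulo \<open>p\<close> cancels the leading error term.\<close>
    define t where "t = - (w * u)"
    have "?p dvd u + poly (pderiv g) b * t"
    proof -
      have "?p dvd (1 - poly (pderiv g) b * w) * u"
        using w by (intro dvd_mult2) (simp add: cong_iff_dvd_diff dvd_diff_commute)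
      thus ?thesis by (simp add: t_def algebra_simps)
    qed
    moreover obtain q where q: "poly g (b + P * t) = poly g b + (P * t) * poly (pderiv g) b + (P * t) ^ 2 * q"
      using poly_taylor_int by blast
    have "poly g (b + P * t) = P * ((u + poly (pderiv g) b * t) + ?p * (?p ^ n * t ^ 2 * q))"
      unfolding q u by (simp add: P_def power2_eq_square algebra_simps)
    ultimately have "P * ?p dvd poly g (b + P * t)"
      by (metis dvd_add dvd_triv_left mult_dvd_mono dvd_refl)
    hence "?p ^ Suc (Suc n) dvd poly g (b + P * t)" by (simp add: P_def mult_ac)
    moreover have "?p dvd b + P * t - a"
    proof -
      have "?p dvd (b - a) + P * t" using b by (intro dvd_add) (auto simp: P_def)
      thus ?thesis by (simp add: algebra_simps)
    qed
    ultimately show "\<exists>y. (?p ^ Suc (Suc n) dvd poly g y \<and> ?p dvd y - a) \<and> ?p ^ Suc n dvd y - b"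
      by (intro exI[of _ "b + P * t"]) (auto simp: P_def)
  qed
  then obtain b where b: "\<And>n. ?p ^ Suc n dvd poly g (b n)" "\<And>n. ?p dvd b n - a"
    "\<And>n. ?p ^ Suc n dvd b (Suc n) - b n" by blast
  have far: "?p ^ Suc n dvd b (n + k) - b n" for n k
  proof (induction k)
    case (Suc k)
    have "?p ^ Suc n dvd ?p ^ Suc (n + k)" by (intro le_imp_power_dvd) simp
    hence "?p ^ Suc n dvd (b (Suc (n + k)) - b (n + k)) + (b (n + k) - b n)"
      using b(3)[of "n + k"] Suc by (intro dvd_add) (auto intro: dvd_trans)
    thus ?case by simp
  qed auto
  have eps: "(\<lambda>n. (1 / real CARD('a)) ^ Suc n) \<longlonglongrightarrow> 0"
    using p1 by (intro LIMSEQ_Suc LIMSEQ_power_zero) auto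
  have cau: "padic_cauchy CARD('a) (\<lambda>n. of_int (b n))"
    unfolding padic_cauchy_def
  proof (intro allI impI)
    fix e :: real assume "e > 0"
    then obtain N where N: "(1 / real CARD('a)) ^ Suc N < e"
      using order_tendstoD(2)[OF eps] by (meson eventually_sequentially order_refl)
    have "padic_abs CARD('a) (of_int (b m) - of_int (b n)) < e" if "m \<ge> N" "n \<ge> N" for m n
    proof -
      have "?p ^ Suc N dvd (b (N + (m - N)) - b N) - (b (N + (n - N)) - b N)"
        by (intro dvd_diff far)
      hence "?p ^ Suc N dvd b m - b n" using that by simp
      hence "padic_abs CARD('a) (of_int (b m - b n)) \<le> (1 / real CARD('a)) ^ Suc N"
        by (simp only: padic_abs_of_int_le_iff)
      thus ?thesis using N by simp
    qed
    thus "\<exists>N. \<forall>m\<ge>N. \<forall>n\<ge>N. padic_abs CARD('a) (of_int (b m) - of_int (b n)) < e" by blast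
  qed
  define x :: "'a padic" where "x = padic_of_seq (\<lambda>n. of_int (b n))"
  have G: "padic_cauchy CARD('a) (\<lambda>n. of_int (poly g (b n)))"
    "poly (map_poly of_int g) x = padic_of_seq (\<lambda>n. of_int (poly g (b n)))"
    using poly_padic_of_seq[OF cau, of g] by (auto simp: x_def)
  have "padic_null CARD('a) (\<lambda>n. of_int (poly g (b n)))"
  proof (rule padic_null_le[OF prime_card eps])
    show "\<forall>\<^sub>F n in sequentially. padic_abs CARD('a) (of_int (poly g (b n))) \<le> (1 / real CARD('a)) ^ Suc n"
      unfolding padic_abs_of_int_le_iff using b(1) by simp
  qed
  hence "poly (map_poly of_int g) x = padic_of_seq (\<lambda>n. 0)"
    unfolding G(2) using padic_of_seq_eq_iff[OF G(1), of "\<lambda>n. 0"] by simp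
  hence 1: "poly (map_poly of_int g) x = 0" by (simp add: padic_of_seq_0)
  have ca: "padic_cauchy CARD('a) (\<lambda>n. of_int (poly [:-a, 1:] (b n)))"
    "poly (map_poly of_int [:-a, 1:]) x = padic_of_seq (\<lambda>n. of_int (poly [:-a, 1:] (b n)))"
    using poly_padic_of_seq[OF cau, of "[:-a, 1:]"] by (auto simp: x_def)
  have "x - of_int a = padic_of_seq (\<lambda>n. of_int (poly [:-a, 1:] (b n)))"
    unfolding ca(2)[symmetric] by (simp add: map_poly_pCons)
  moreover have "padic_abs CARD('a) (of_int (poly [:-a, 1:] (b n))) \<le> (1 / real CARD('a)) ^ 1" for n
    unfolding padic_abs_of_int_le_iff using b(2)[of n] by simp
  ultimately have "padic_norm (x - of_int a) \<le> 1 / real CARD('a)"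
    using tendsto_upperbound[OF tendsto_padic_norm[OF ca(1)]] by simp
  also have "\<dots> < 1" using p1 by simp
  finally show ?thesis using that 1 by blast
qed

text \<open>Modulo \<open>p\<close> the polynomial is \<open>d (x ^ (p - 1) - 1)\<close>, which has all the \<open>p - 1\<close> nonzero residues as
  simple zeros; each of them lifts.\<close>

lemma unit_roots_of_trinomial:
  fixes d e u :: int and N :: nat
  assumes d: "\<not> int CARD('a) dvd d" and de: "int CARD('a) dvd d + e"
  obtains S :: "'a::prime_card padic set" where "finite S" "card S = CARD('a) - 1"
    "\<And>x. x \<in> S \<Longrightarrow> padic_norm x = 1"
    "\<And>x. x \<in> S \<Longrightarrow> of_int (int CARD('a) * u) * x ^ N + of_int d * x ^ (CARD('a) - 1) + of_int e = 0"
proof -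
  let ?p = "int CARD('a)"
  have p: "prime ?p" by (rule prime_card_int)
  have p1: "CARD('a) > 1" using prime_gt_1_nat[OF prime_card[where 'a='a]] .
  define g where "g = monom (?p * u) N + monom d (CARD('a) - 1) + [:e:]"
  have ex: "\<exists>x :: 'a padic. poly (map_poly of_int g) x = 0 \<and> padic_norm (x - of_int (int a)) < 1"
    if a: "a \<in> {1..CARD('a) - 1}" for a
  proof -
    have na: "\<not> CARD('a) dvd a" using a by (auto dest: dvd_imp_le)
    hence na': "\<not> ?p dvd int a" by simp
    have "[a ^ (CARD('a) - 1) = 1] (mod CARD('a))"
      by (rule fermat_theorem[OF prime_card na])
    hence f: "[int a ^ (CARD('a) - 1) = 1] (mod ?p)"
      by (metis cong_int_iff of_nat_1 of_nat_power)
    have "?p dvd d * (int a ^ (CARD('a) - 1) - 1)"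
      using f by (intro dvd_mult) (simp add: cong_iff_dvd_diff)
    hence "?p dvd ?p * (u * int a ^ N) + (d * (int a ^ (CARD('a) - 1) - 1) + (d + e))"
      using de by (intro dvd_add[OF _ dvd_add]) auto
    hence 1: "?p dvd poly g (int a)" by (simp add: g_def poly_monom algebra_simps)
    have 2: "\<not> ?p dvd poly (pderiv g) (int a)"
    proof
      assume *: "?p dvd poly (pderiv g) (int a)"
      have "poly (pderiv g) (int a)
          = ?p * (of_nat N * u * int a ^ (N - 1)) + of_nat (CARD('a) - 1) * d * int a ^ (CARD('a) - 1 - 1)"
        by (simp add: g_def pderiv_add pderiv_monom pderiv_pCons poly_monom algebra_simps)
      hence "?p dvd of_nat (CARD('a) - 1) * d * int a ^ (CARD('a) - 1 - 1)"
        using * by (metis dvd_add_right_iff dvd_triv_left)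
      hence "?p dvd of_nat (CARD('a) - 1)"
        using d na' p by (meson prime_dvd_mult_iff prime_dvd_power)
      hence "CARD('a) dvd CARD('a) - 1" by (simp only: int_dvd_int_iff)
      thus False using p1 by (auto dest: dvd_imp_le)
    qed
    show ?thesis using hensel[OF 1 2] by blast
  qed
  define \<xi> :: "nat \<Rightarrow> 'a padic" where "\<xi> = (\<lambda>a. SOME x. poly (map_poly of_int g) x = 0 \<and> padic_norm (x - of_int (int a)) < 1)"
  have \<xi>: "poly (map_poly of_int g) (\<xi> a) = 0" "padic_norm (\<xi> a - of_int (int a)) < 1"
    if "a \<in> {1..CARD('a) - 1}" for a
    using someI_ex[OF ex[OF that]] by (simp_all add: \<xi>_def)
  have inj: "inj_on \<xi> {1..CARD('a) - 1}"
  proof (rule inj_onI)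
    fix a b assume a: "a \<in> {1..CARD('a) - 1}" and b: "b \<in> {1..CARD('a) - 1}" and ab: "\<xi> a = \<xi> b"
    have "padic_norm ((\<xi> b - of_int (int b)) - (\<xi> a - of_int (int a)) :: 'a padic) < 1"
      using padic_norm_diff_le_max \<xi>(2)[OF a] \<xi>(2)[OF b] by (meson le_less_trans max_less_iff_conj)
    hence "padic_norm (of_int (int a - int b) :: 'a padic) < 1" using ab by simp
    hence "?p dvd int a - int b" using padic_norm_of_int_eq_1_iff[of "int a - int b", where 'a='a] by force
    hence "int a mod ?p = int b mod ?p" by (simp add: mod_eq_dvd_iff)
    moreover have "int a mod ?p = int a" "int b mod ?p = int b" using a b p1 by auto
    ultimately show "a = b" by simp
  qed
  show ?thesis
  proof (rule that[of "\<xi> ` {1..CARD('a) - 1}"])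
    fix x assume "x \<in> \<xi> ` {1..CARD('a) - 1}"
    then obtain a where a: "a \<in> {1..CARD('a) - 1}" "x = \<xi> a" by blast
    have "\<not> CARD('a) dvd a" using a by (auto dest: dvd_imp_le)
    hence n1: "padic_norm (of_int (int a) :: 'a padic) = 1" unfolding padic_norm_of_int_eq_1_iff by simp
    have "padic_norm ((x - of_int (int a)) + of_int (int a)) = padic_norm (of_int (int a) :: 'a padic)"
      using \<xi>(2)[OF a(1)] a(2) n1 by (intro padic_norm_add_eq_right) simp
    thus "padic_norm x = 1" using n1 by simp
    have "map_poly of_int g = monom (of_int (?p * u)) N + monom (of_int d) (CARD('a) - 1) + [:of_int e :: 'a padic:]"
      by (rule poly_eqI) (simp add: g_def coeff_map_poly coeff_pCons split: nat.splits)
    thus "of_int (?p * u) * x ^ N + of_int d * x ^ (CARD('a) - 1) + of_int e = 0"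
      using \<xi>(1)[OF a(1)] a(2) by (simp add: poly_monom)
  qed (use card_image[OF inj] in simp_all)
qed

section \<open>A trinomial with many zeros\<close>

lemma one_plus_power_cubic: "\<exists>s::int. (1 + h) ^ n = 1 + int n * h + int (n choose 2) * h ^ 2 + h ^ 3 * s"
proof (induction n)
  case (Suc n)
  then obtain s where s: "(1 + h) ^ n = 1 + int n * h + int (n choose 2) * h ^ 2 + h ^ 3 * s" by blast
  have c: "Suc n choose 2 = n + (n choose 2)" by (simp add: numeral_2_eq_2)
  have "(1 + h) ^ Suc n = 1 + int (Suc n) * h + int (Suc n choose 2) * h ^ 2 + h ^ 3 * (int (n choose 2) + s + h * s)"
    unfolding c power_Suc s by (simp add: algebra_simps power2_eq_square power3_eq_cube)
  thus ?case by blast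
qed (auto intro: exI[of _ 0])

text \<open>A sharp form of lifting the exponent.  For odd \<open>p\<close> the quadratic term of the binomial expansion
  gains a factor \<open>p\<close> from \<open>p choose 2\<close> and hence disappears in the remainder.\<close>

lemma one_plus_prime_power:
  assumes "odd (p::nat)"
  shows "\<exists>t::int. (1 + int p) ^ (p ^ k) = 1 + int p ^ Suc k * (1 + int p * t)"
proof (induction k)
  case (Suc k)
  then obtain t where t: "(1 + int p) ^ (p ^ k) = 1 + int p ^ Suc k * (1 + int p * t)" by blast
  define y where "y = 1 + int p * t"
  define h where "h = int p ^ Suc k * y"
  obtain s where s: "(1 + h) ^ p = 1 + int p * h + int (p choose 2) * h ^ 2 + h ^ 3 * s"
    using one_plus_power_cubic by blast
  obtain r where r: "p = 2 * r + 1" using assms by (auto elim: oddE)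
  have "p choose 2 = p * r" unfolding choose_two by (simp add: r)
  hence c: "int (p choose 2) = int p * int r" by simp
  have "(1 + int p) ^ (p ^ Suc k) = ((1 + int p) ^ (p ^ k)) ^ p"
    by (simp add: power_mult[symmetric] mult.commute)
  also have "\<dots> = 1 + int p * h + int p * int r * h ^ 2 + h ^ 3 * s" unfolding t y_def[symmetric] h_def[symmetric] s c ..
  also have "\<dots> = 1 + int p ^ Suc (Suc k) * (y + int p * (int p ^ k * y ^ 2 * (int r + int p ^ k * y * s)))"
    by (simp add: h_def power2_eq_square power3_eq_cube algebra_simps)
  also have "\<dots> = 1 + int p ^ Suc (Suc k) * (1 + int p * (t + int p ^ k * y ^ 2 * (int r + int p ^ k * y * s)))"
    by (simp add: y_def algebra_simps)
  finally show ?case by blast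
qed (auto intro: exI[of _ 0])

text \<open>Put \<open>m = p ^ (p - 1)\<close> and \<open>b = (1 + p) ((1 + p) ^ m - 1) / p\<close>.  The polynomial
  \<open>z ^ (m + 1) - (1 + b) z + b\<close> vanishes at \<open>1\<close> for every \<open>b\<close>, and \<open>b\<close> is chosen so that it vanishes at
  \<open>1 + p\<close> as well.  A third zero is close to \<open>b\<close>, which is \<open>p ^ (p - 1)\<close> times an integer
  congruent to \<open>1\<close>; the exponent \<open>p - 1\<close> in \<open>m\<close> serves just this purpose.  These three zeros are
  therefore powers with exponent \<open>p - 1\<close>, so substituting \<open>z = x ^ (p - 1)\<close>
  yields \<open>p - 1\<close> zeros from each of them.\<close>

lemma fewnomial_many_roots:
  assumes p5: "CARD('a) \<ge> 5"
  shows "\<exists>F \<in> (fewnomials 2 :: 'a::prime_card padic poly set). 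
     3 * (CARD('a) - 1) \<le> card {x. x \<noteq> 0 \<and> poly F x = 0}"
proof -
  define q where "q = CARD('a)"
  define m where "m = q ^ (q - 1)"
  have q: "prime q" unfolding q_def by (rule prime_card)
  have q5: "q \<ge> 5" using p5 by (simp add: q_def)
  have oddq: "odd q" using q q5 prime_odd_nat by auto
  have qS: "q = Suc (q - 1)" using q5 by simp
  obtain t where t: "(1 + int q) ^ m = 1 + int q ^ q * (1 + int q * t)"
    using one_plus_prime_power[OF oddq, of "q - 1"] qS unfolding m_def by metis
  define c where "c = (1 + int q) * (1 + int q * t)"
  define b where "b = int q ^ (q - 1) * c"
  have qq: "int q ^ q = int q * int q ^ (q - 1)" using qS by (metis power_Suc)
  have b: "b * int q = (1 + int q) * ((1 + int q) ^ m - 1)"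
    unfolding t by (simp add: b_def c_def qq algebra_simps)
  define F :: "'a padic poly" where
    "F = monom 1 ((q - 1) * Suc m) + monom (- of_int (1 + b)) (q - 1) + [:of_int b:]"
  have F: "poly F x = x ^ ((q - 1) * Suc m) - of_int (1 + b) * x ^ (q - 1) + of_int b" for x
    by (simp add: F_def poly_monom algebra_simps)
  have m0: "m > 0" using q5 by (simp add: m_def)
  have "coeff F ((q - 1) * Suc m) = 1" using q5 m0
    by (auto simp: F_def coeff_pCons split: nat.splits)
  hence F0: "F \<noteq> 0" by auto
  have Ff: "F \<in> fewnomials 2"
  proof -
    have "coeff F i = 0" if "i \<notin> {0, q - 1, (q - 1) * Suc m}" for i
      using that by (cases i) (auto simp: F_def simp del: mult_Suc_right)
    hence "{i. coeff F i \<noteq> 0} \<subseteq> {0, q - 1, (q - 1) * Suc m}" by blast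
    hence "card {i. coeff F i \<noteq> 0} \<le> card {0, q - 1, (q - 1) * Suc m}"
      by (intro card_mono) auto
    also have "\<dots> \<le> 3" using card_insert_le_m1[of 3] by (simp add: card_insert_if)
    finally show ?thesis using F0 by (simp add: fewnomials_def)
  qed
  have nq1: "\<not> int q dvd 1" using q5 by auto
  obtain S1 :: "'a padic set" where S1: "finite S1" "card S1 = q - 1"
    "\<And>x. x \<in> S1 \<Longrightarrow> padic_norm x = 1" "\<And>x. x \<in> S1 \<Longrightarrow> x ^ (q - 1) = 1"
    using unit_roots_of_trinomial[of 1 "-1" 0 0, where 'a='a] nq1 unfolding q_def by auto
  obtain S2 :: "'a padic set" where S2: "finite S2" "card S2 = q - 1"
    "\<And>x. x \<in> S2 \<Longrightarrow> padic_norm x = 1" "\<And>x. x \<in> S2 \<Longrightarrow> x ^ (q - 1) = of_int (1 + int q)"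
  proof -
    have "int CARD('a) dvd 1 + - (1 + int CARD('a))" by simp
    then obtain S :: "'a padic set" where S: "finite S" "card S = CARD('a) - 1"
      "\<And>x. x \<in> S \<Longrightarrow> padic_norm x = 1"
      "\<And>x. x \<in> S \<Longrightarrow> of_int (int CARD('a) * 0) * x ^ 0 + of_int 1 * x ^ (CARD('a) - 1) + of_int (- (1 + int CARD('a))) = 0"
      using unit_roots_of_trinomial[of 1 "- (1 + int CARD('a))" 0 0, where 'a='a] nq1 unfolding q_def by metis
    have "x ^ (q - 1) = of_int (1 + int q)" if "x \<in> S" for x
    proof -
      have "x ^ (CARD('a) - 1) + - of_int (1 + int CARD('a)) = 0"
        using S(4)[OF that]
        by (simp only: mult_zero_right mult_zero_left of_int_0 add_0 of_int_1 mult_1 of_int_minus)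
      thus ?thesis unfolding q_def by (metis eq_neg_iff_add_eq_0 minus_minus)
    qed
    thus ?thesis using that S unfolding q_def by blast
  qed
  \<comment> \<open>The zeros over the third one have norm \<open>1/q\<close>.  Writing them as \<open>q w\<close> and dividing by
     \<open>q ^ (q - 1)\<close> produces a trinomial in \<open>w\<close> with unit zeros.  Its leading coefficient
     \<open>q ^ ((q - 1) * m)\<close> is displayed with one factor \<open>q\<close> split off.\<close>
  have dvb: "int q dvd b" using q5 by (auto simp: b_def intro!: dvd_mult2)
  obtain S3 :: "'a padic set" where S3: "finite S3" "card S3 = q - 1"
    "\<And>x. x \<in> S3 \<Longrightarrow> padic_norm x = 1"
    "\<And>x. x \<in> S3 \<Longrightarrow> of_int (int q * int q ^ ((q - 1) * m - 1)) * x ^ ((q - 1) * Suc m)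
        + of_int (- (1 + b)) * x ^ (q - 1) + of_int c = 0"
  proof -
    have 1: "\<not> int CARD('a) dvd - (1 + b)"
      using dvb nq1 unfolding q_def by (metis dvd_add_left_iff dvd_minus_iff)
    have "c - 1 = int q * (1 + t * (1 + int q))" by (simp add: c_def algebra_simps)
    hence "int q dvd c - 1 - b" using dvb by (metis dvd_diff dvd_triv_left)
    hence 2: "int CARD('a) dvd - (1 + b) + c" by (simp add: q_def algebra_simps)
    show ?thesis using that unit_roots_of_trinomial[OF 1 2] unfolding q_def by metis
  qed
  let ?T = "(\<lambda>w. of_nat q * w) ` S3"
  have qn: "padic_norm (of_nat q :: 'a padic) = 1 / real q" unfolding q_def by (rule padic_norm_prime)
  have z1: "poly F x = 0" if "x \<in> S1" for x
    unfolding F power_mult S1(4)[OF that] by simp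
  have z2: "poly F x = 0" if "x \<in> S2" for x
  proof -
    have "poly F x = of_int ((1 + int q) ^ Suc m - (1 + b) * (1 + int q) + b)"
      unfolding F power_mult S2(4)[OF that] by simp
    also have "(1 + int q) ^ Suc m - (1 + b) * (1 + int q) + b = 0"
      using b by (simp add: algebra_simps)
    finally show ?thesis by simp
  qed
  have z3: "poly F (of_nat q * w) = 0" if "w \<in> S3" for w
  proof -
    have e: "(q - 1) * Suc m = (q - 1) + Suc ((q - 1) * m - 1)" using q5 m0 by simp
    have "(of_nat q * w) ^ ((q - 1) * Suc m)
        = of_nat q ^ (q - 1) * (of_int (int q * int q ^ ((q - 1) * m - 1)) * w ^ ((q - 1) * Suc m))"
      unfolding power_mult_distrib by (subst (1) e) (simp add: power_add mult_ac)
    moreover have "of_int b = of_nat q ^ (q - 1) * (of_int c :: 'a padic)" by (simp add: b_def)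
    ultimately have "poly F (of_nat q * w) = of_nat q ^ (q - 1) *
       (of_int (int q * int q ^ ((q - 1) * m - 1)) * w ^ ((q - 1) * Suc m)
        + of_int (- (1 + b)) * w ^ (q - 1) + of_int c)"
      unfolding F by (simp only: power_mult_distrib) (simp add: algebra_simps)
    thus ?thesis using S3(4)[OF that] by simp
  qed
  have Tn: "padic_norm x = 1 / real q" if "x \<in> ?T" for x
    using that S3(3) qn by (auto simp: padic_norm_mult)
  have q0: "(of_nat q :: 'a padic) \<noteq> 0" using q5 by simp
  have cT: "card ?T = q - 1" using S3(2) q0 by (subst card_image) (auto intro!: inj_onI)
  have d12: "S1 \<inter> S2 = {}"
  proof (rule ccontr)
    assume "S1 \<inter> S2 \<noteq> {}"
    then obtain x where "x \<in> S1" "x \<in> S2" by blast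
    hence "(1 :: 'a padic) = 1 + of_nat q" using S1(4)[of x] S2(4)[of x] by simp
    thus False using q0 by simp
  qed
  have d3: "(S1 \<union> S2) \<inter> ?T = {}"
  proof (rule ccontr)
    assume "(S1 \<union> S2) \<inter> ?T \<noteq> {}"
    then obtain x where x: "x \<in> S1 \<union> S2" "x \<in> ?T" by blast
    have "padic_norm x = 1" using x(1) S1(3) S2(3) by auto
    thus False using Tn[OF x(2)] q5 by simp
  qed
  have "card (S1 \<union> S2 \<union> ?T) = 3 * (q - 1)"
    using S1 S2 S3 cT d12 d3 by (simp add: card_Un_disjoint)
  moreover have "S1 \<union> S2 \<union> ?T \<subseteq> {x. x \<noteq> 0 \<and> poly F x = 0}"
  proof
    fix x assume x: "x \<in> S1 \<union> S2 \<union> ?T"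
    have "padic_norm x \<noteq> 0" using x S1(3) S2(3) Tn[of x] q5 by force
    thus "x \<in> {x. x \<noteq> 0 \<and> poly F x = 0}" using x z1 z2 z3 by auto
  qed
  moreover have "finite {x. x \<noteq> 0 \<and> poly F x = 0}" using poly_roots_finite[OF F0] by simp
  ultimately have "3 * (q - 1) \<le> card {x. x \<noteq> 0 \<and> poly F x = 0}" by (metis card_mono)
  thus ?thesis using Ff unfolding q_def by blast
qed

section \<open>The values of both suprema\<close>

lemma B1_le_Bm: "B1 t TYPE('a::field) \<le> Bm t TYPE('a)"
  unfolding B1_def Bm_def
proof (rule SUP_mono)
  fix f :: "'a poly" assume f: "f \<in> fewnomials t"
  hence f0: "f \<noteq> 0" by (simp add: fewnomials_def)
  have "card {x. x \<noteq> 0 \<and> poly f x = 0} = (\<Sum>x | x \<noteq> 0 \<and> poly f x = 0. 1)" by simp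
  also have "\<dots> \<le> (\<Sum>x | x \<noteq> 0 \<and> poly f x = 0. order x f)"
    using f0 by (intro sum_mono) (auto simp: order_root Suc_le_eq)
  finally show "\<exists>g\<in>(fewnomials t :: 'a poly set). enat (card {x. x \<noteq> 0 \<and> poly f x = 0})
      \<le> enat (\<Sum>x | x \<noteq> 0 \<and> poly g x = 0. order x g)" using f by (intro bexI[of _ f]) auto
qed

theorem mainTheorem5:
  fixes p :: nat
  assumes "p = CARD('p::prime_card)" and "p \<ge> 5"
  shows "B1 2 TYPE('p padic) = Bm 2 TYPE('p padic) \<and>
         Bm 2 TYPE('p padic) = enat (3 * (p - 1))"
proof -
  have p5: "CARD('p) \<ge> 5" using assms by simp
  have "Bm 2 TYPE('p padic) \<le> enat (3 * (p - 1))"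
    unfolding Bm_def assms(1) using fewnomial_sum_order_le[OF p5] by (intro SUP_least) auto
  moreover have "enat (3 * (p - 1)) \<le> B1 2 TYPE('p padic)"
  proof -
    obtain F :: "'p padic poly" where F: "F \<in> fewnomials 2"
      "3 * (CARD('p) - 1) \<le> card {x. x \<noteq> 0 \<and> poly F x = 0}"
      using fewnomial_many_roots[OF p5] by blast
    have "enat (3 * (p - 1)) \<le> enat (card {x. x \<noteq> 0 \<and> poly F x = 0})"
      using F(2) assms(1) by simp
    also have "\<dots> \<le> B1 2 TYPE('p padic)" unfolding B1_def by (rule SUP_upper[OF F(1)])
    finally show ?thesis .
  qed
  moreover have "B1 2 TYPE('p padic) \<le> Bm 2 TYPE('p padic)" by (rule B1_le_Bm)
  ultimately show ?thesis by (metis order.antisym order.trans)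
qed

end
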